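(* Fix constants $\kappa>0$, $\lambda\ge 0$, $\mu\in[0,1)$, $K\ge 1$ and $A>0$. Then there exist constants $\alpha_0\in(0,1)$, $\eta_0\in(0,1/\kappa)$ and $C>0$, depending only on $\kappa,\lambda,\mu,K,A$, such that the following holds for all $\alpha\in(0,\alpha_0]$ and $\eta\in(0,\eta_0]$. Set $$\gamma:=\frac{\kappa\alpha\eta}{1-\kappa\eta},\qquad \overline{\lambda}:=\lambda+\frac{(1-\mu)\kappa}{1-\eta\kappa}.$$ Let $L:\mathbb{R}^N\to\mathbb{R}$ be differentiable, let $\mathcal{D}:\mathbb{R}^N\times\mathbb{R}^N\to\mathbb{R}$ be differentiable in its first argument, and let $H:\mathbb{R}^N\to\mathbb{R}^{N\times N}$ be such that $H(\theta)$ is symmetric positive-definite for every $\theta$ and, for every $\theta'$, $$\mathcal{D}(\theta,\theta')=\tfrac12(\theta-\theta')^{\top}H(\theta')(\theta-\theta')+o(\|\theta-\theta'\|^2)\quad\text{as }\theta\to\theta'.$$ Assume that $L,\mathcal{D},H$ satisfy the regularity condition (stated in the context) with constant $K$ for the two values $\lambda'\in\{\lambda,\overline{\lambda}\}$. Let $\theta_0\in\mathbb{R}^N$, and let $T\ge 1$ be an integer with $T\gamma\le A$. Let $(\theta_t)_{0\le t\le T}$ be the iterates of the mean teacher algorithm (stated in the context) with learning rate $\eta$, damping parameter $\lambda$, momentum $\mu$, weight $\alpha$, contraction parameter $\kappa$, number of steps $T$ and starting point $\theta_0$. Let $(\overline{\theta}_t)_{0\le t\le T}$ be defined by $$\overline{\theta}_0=\theta_0,\qquad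 \overline{\theta}_{t+1}=\overline{\theta}_t-\gamma\,H_{\overline{\lambda}}(\overline{\theta}_t)^{-1}\nabla L(\overline{\theta}_t).$$ Then $$\max_{t\le T}\|\theta_t-\overline{\theta}_t\|\le C\,\alpha\log(1/\alpha).$$
   Context: For $\lambda'\ge 0$ write $H_{\lambda'}(\theta):=H(\theta)+\lambda' I$ and $\mathcal{D}_{\lambda'}(\theta,\theta'):=\mathcal{D}(\theta,\theta')+\frac{\lambda'}{2}\|\theta-\theta'\|^2$. Norms are Euclidean for vectors and operator norms for matrices. Mean teacher algorithm: initialize $\theta_0':=\theta_0$ and $\theta_{-1}:=\theta_0$ (zero initial momentum). For $t=1,\dots,T$: $$\theta_t=\theta_{t-1}-\eta\,\nabla_\theta\{\alpha L(\theta)+\mathcal{D}_\lambda(\theta,\theta_{t-1}')\}\big|_{\theta=\theta_{t-1}}+\mu(\theta_{t-1}-\theta_{t-2}),$$ $$\theta_t'=(1-\eta\kappa)\theta_{t-1}'+\eta\kappa\,\theta_t.$$ Regularity condition with constant $K\ge1$: for all $\theta,\theta'\in\mathbb{R}^N$ and $\lambda'\in\{\lambda,\overline{\lambda}\}$, - $\|H_{\lambda'}(\theta)\|\le K$; - $\|H_{\lambda'}(\theta)^{-1}\nabla L(\theta)-H_{\lambda'}(\theta')^{-1}\nabla L(\theta')\|\le K\|\theta-\theta'\|$; - $\|\nabla_\theta\mathcal{D}(\theta,\theta')-H(\theta)(\theta-\theta')\|\le K\|\theta-\theta'\|^2$; - $\|H_{\lambda'}(\theta)^{-1}\nabla L(\theta)\|\le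 K$. *)

theory Defs
  imports
    Complex_Main
    "HOL-Library.Landau_Symbols"
    "Jordan_Normal_Form.Gauss_Jordan_Elimination"
    "Jordan_Normal_Form.Determinant"
begin

text \<open>
  The constants of the theorem must not depend on the dimension \<open>N\<close>, so \<open>N\<close> is quantified inside
  the formula: \<open>\<real>\<^sup>N\<close> is \<open>carrier_vec N\<close> and \<open>\<real>\<^sup>N\<^sup>\<times>\<^sup>N\<close> is \<open>carrier_mat N N\<close>. These carriers have no
  topology in the library; norms, limits and gradients are introduced here.
\<close>

definition euclid_norm :: "real vec \<Rightarrow> real" where
  "euclid_norm v = sqrt (v \<bullet> v)"

text \<open>Same form as \<open>onorm\<close> in HOL-Analysis; the zero vector contributes \<open>0 / 0 = 0\<close>.\<close>

definition op_norm :: "real mat \<Rightarrow> real" where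
  "op_norm A = (SUP x\<in>carrier_vec (dim_col A). euclid_norm (A *\<^sub>v x) / euclid_norm x)"

definition sym_pos_def :: "nat \<Rightarrow> real mat \<Rightarrow> bool" where
  "sym_pos_def N A \<longleftrightarrow> A \<in> carrier_mat N N \<and> transpose_mat A = A \<and>
     (\<forall>x\<in>carrier_vec N. x \<noteq> 0\<^sub>v N \<longrightarrow> x \<bullet> (A *\<^sub>v x) > 0)"

text \<open>The filter of punctured neighbourhoods of \<open>x\<close> in \<open>\<real>\<^sup>N\<close>.\<close>

definition vec_at :: "nat \<Rightarrow> real vec \<Rightarrow> real vec filter" where
  "vec_at N x = inf (filtercomap (\<lambda>y. euclid_norm (y - x)) (at_right 0)) (principal (carrier_vec N))"

definition has_gradient :: "nat \<Rightarrow> (real vec \<Rightarrow> real) \<Rightarrow> real vec \<Rightarrow> real vec \<Rightarrow> bool" where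
  "has_gradient N f g x \<longleftrightarrow> g \<in> carrier_vec N \<and>
     (\<lambda>y. f y - f x - g \<bullet> (y - x)) \<in> o[vec_at N x](\<lambda>y. euclid_norm (y - x))"

definition differentiable_vec :: "nat \<Rightarrow> (real vec \<Rightarrow> real) \<Rightarrow> bool" where
  "differentiable_vec N f \<longleftrightarrow> (\<forall>x\<in>carrier_vec N. \<exists>g. has_gradient N f g x)"

definition gradient :: "nat \<Rightarrow> (real vec \<Rightarrow> real) \<Rightarrow> real vec \<Rightarrow> real vec" where
  "gradient N f x = (THE g. has_gradient N f g x)"

definition damped_mat :: "nat \<Rightarrow> real \<Rightarrow> (real vec \<Rightarrow> real mat) \<Rightarrow> real vec \<Rightarrow> real mat" where
  "damped_mat N l H \<theta> = H \<theta> + l \<cdot>\<^sub>m 1\<^sub>m N"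

definition damped_div :: "real \<Rightarrow> (real vec \<Rightarrow> real vec \<Rightarrow> real) \<Rightarrow> real vec \<Rightarrow> real vec \<Rightarrow> real" where
  "damped_div l D \<theta> \<theta>' = D \<theta> \<theta>' + l / 2 * (euclid_norm (\<theta> - \<theta>'))\<^sup>2"

text \<open>
  \<open>H\<^bsub>l\<^esub>(\<theta>)\<^sup>-\<^sup>1 \<nabla>L(\<theta>)\<close>. For \<open>l \<ge> 0\<close> and positive definite \<open>H \<theta>\<close> the option returned by \<open>mat_inverse\<close>
  is never \<open>None\<close>; see \<open>mat_inverse_damped_mat\<close> below.
\<close>

definition natural_grad ::
  "nat \<Rightarrow> real \<Rightarrow> (real vec \<Rightarrow> real) \<Rightarrow> (real vec \<Rightarrow> real mat) \<Rightarrow> real vec \<Rightarrow> real vec" where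
  "natural_grad N l L H \<theta> = the (mat_inverse (damped_mat N l H \<theta>)) *\<^sub>v gradient N L \<theta>"

definition locally_quadratic ::
  "nat \<Rightarrow> (real vec \<Rightarrow> real vec \<Rightarrow> real) \<Rightarrow> (real vec \<Rightarrow> real mat) \<Rightarrow> bool" where
  "locally_quadratic N D H \<longleftrightarrow> (\<forall>\<theta>'\<in>carrier_vec N.
     (\<lambda>\<theta>. D \<theta> \<theta>' - 1 / 2 * ((\<theta> - \<theta>') \<bullet> (H \<theta>' *\<^sub>v (\<theta> - \<theta>'))))
       \<in> o[vec_at N \<theta>'](\<lambda>\<theta>. (euclid_norm (\<theta> - \<theta>'))\<^sup>2))"

definition regularity_condition ::
  "nat \<Rightarrow> real \<Rightarrow> real set \<Rightarrow> (real vec \<Rightarrow> real) \<Rightarrow> (real vec \<Rightarrow> real vec \<Rightarrow> real) \<Rightarrow>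
   (real vec \<Rightarrow> real mat) \<Rightarrow> bool" where
  "regularity_condition N K \<Lambda> L D H \<longleftrightarrow>
     (\<forall>\<theta>\<in>carrier_vec N. \<forall>\<theta>'\<in>carrier_vec N. \<forall>l\<in>\<Lambda>.
        op_norm (damped_mat N l H \<theta>) \<le> K \<and>
        euclid_norm (natural_grad N l L H \<theta> - natural_grad N l L H \<theta>') \<le> K * euclid_norm (\<theta> - \<theta>') \<and>
        euclid_norm (gradient N (\<lambda>x. D x \<theta>') \<theta> - H \<theta> *\<^sub>v (\<theta> - \<theta>')) \<le> K * (euclid_norm (\<theta> - \<theta>'))\<^sup>2 \<and>
        euclid_norm (natural_grad N l L H \<theta>) \<le> K)"

text \<open>The state after step \<open>t\<close> is the triple \<open>(\<theta>\<^sub>t, \<theta>\<^sub>t\<^sub>-\<^sub>1, \<theta>'\<^sub>t)\<close>.\<close>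

primrec mean_teacher_state ::
  "nat \<Rightarrow> (real vec \<Rightarrow> real) \<Rightarrow> (real vec \<Rightarrow> real vec \<Rightarrow> real) \<Rightarrow> real \<Rightarrow> real \<Rightarrow> real \<Rightarrow> real \<Rightarrow> real \<Rightarrow>
   real vec \<Rightarrow> nat \<Rightarrow> real vec \<times> real vec \<times> real vec" where
  "mean_teacher_state N L D \<eta> l \<mu> \<alpha> \<kappa> \<theta>0 0 = (\<theta>0, \<theta>0, \<theta>0)"
| "mean_teacher_state N L D \<eta> l \<mu> \<alpha> \<kappa> \<theta>0 (Suc t) =
     (let (\<theta>, \<theta>_prev, \<theta>') = mean_teacher_state N L D \<eta> l \<mu> \<alpha> \<kappa> \<theta>0 t;
          \<theta>_new = \<theta> - \<eta> \<cdot>\<^sub>v gradient N (\<lambda>x. \<alpha> * L x + damped_div l D x \<theta>') \<theta>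
                    + \<mu> \<cdot>\<^sub>v (\<theta> - \<theta>_prev)
      in (\<theta>_new, \<theta>, (1 - \<eta> * \<kappa>) \<cdot>\<^sub>v \<theta>' + (\<eta> * \<kappa>) \<cdot>\<^sub>v \<theta>_new))"

definition mean_teacher ::
  "nat \<Rightarrow> (real vec \<Rightarrow> real) \<Rightarrow> (real vec \<Rightarrow> real vec \<Rightarrow> real) \<Rightarrow> real \<Rightarrow> real \<Rightarrow> real \<Rightarrow> real \<Rightarrow> real \<Rightarrow>
   real vec \<Rightarrow> nat \<Rightarrow> real vec" where
  "mean_teacher N L D \<eta> l \<mu> \<alpha> \<kappa> \<theta>0 t = fst (mean_teacher_state N L D \<eta> l \<mu> \<alpha> \<kappa> \<theta>0 t)"

primrec natural_descent ::
  "nat \<Rightarrow> (real vec \<Rightarrow> real) \<Rightarrow> (real vec \<Rightarrow> real mat) \<Rightarrow> real \<Rightarrow> real \<Rightarrow> real vec \<Rightarrow> nat \<Rightarrow> real vec" where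
  "natural_descent N L H \<gamma> l \<theta>0 0 = \<theta>0"
| "natural_descent N L H \<gamma> l \<theta>0 (Suc t) =
     natural_descent N L H \<gamma> l \<theta>0 t - \<gamma> \<cdot>\<^sub>v natural_grad N l L H (natural_descent N L H \<gamma> l \<theta>0 t)"

lemma euclid_norm_smult:
  assumes "v \<in> carrier_vec N"
  shows "euclid_norm (c \<cdot>\<^sub>v v) = \<bar>c\<bar> * euclid_norm v"
proof -
  have "(c \<cdot>\<^sub>v v) \<bullet> (c \<cdot>\<^sub>v v) = c\<^sup>2 * (v \<bullet> v)"
    using assms by (simp add: power2_eq_square)
  thus ?thesis
    by (simp add: euclid_norm_def real_sqrt_mult)
qed

lemma euclid_norm_pos:
  assumes "v \<in> carrier_vec N" "v \<noteq> 0\<^sub>v N"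
  shows "euclid_norm v > 0"
proof -
  have "\<exists>i<N. v $ i \<noteq> 0"
    using assms by (metis carrier_vecD eq_vecI index_zero_vec(1) index_zero_vec(2))
  then obtain i where i: "i < N" "v $ i \<noteq> 0" by blast
  have "(\<Sum>i<N. v $ i * v $ i) > 0"
    using i by (intro sum_pos2[of _ i]) (auto simp: zero_less_mult_iff)
  thus ?thesis
    using assms by (simp add: euclid_norm_def scalar_prod_def atLeast0LessThan)
qed

lemma has_gradient_unique:
  assumes x: "x \<in> carrier_vec N" and g: "has_gradient N f g x" and h: "has_gradient N f h x"
  shows "g = h"
proof (rule ccontr)
  assume "g \<noteq> h"
  have gN: "g \<in> carrier_vec N" and hN: "h \<in> carrier_vec N"
    using g h by (auto simp: has_gradient_def)
  define d where "d = g - h"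
  have dN: "d \<in> carrier_vec N" using gN hN by (simp add: d_def)
  have d0: "d \<noteq> 0\<^sub>v N"
  proof
    assume "d = 0\<^sub>v N"
    hence "\<forall>i<N. g $ i - h $ i = 0"
      using gN hN unfolding d_def by (metis carrier_vecD index_minus_vec(1) index_zero_vec(1))
    thus False using \<open>g \<noteq> h\<close> gN hN by (auto intro!: eq_vecI)
  qed
  have nd: "euclid_norm d > 0" using euclid_norm_pos[OF dN d0] .
  have lim: "filterlim (\<lambda>t. x + t \<cdot>\<^sub>v d) (vec_at N x) (at_right 0)"
    unfolding vec_at_def filterlim_inf filterlim_filtercomap_iff filterlim_principal
  proof
    have "euclid_norm (x + t \<cdot>\<^sub>v d - x) = \<bar>t\<bar> * euclid_norm d" for t
    proof -
      have "x + t \<cdot>\<^sub>v d - x = t \<cdot>\<^sub>v d" using x dN by (intro eq_vecI) auto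
      thus ?thesis using euclid_norm_smult[OF dN] by simp
    qed
    moreover have "filterlim (\<lambda>t. \<bar>t\<bar> * euclid_norm d) (at_right 0) (at_right 0)"
      unfolding filterlim_at
    proof
      show "((\<lambda>t. \<bar>t\<bar> * euclid_norm d) \<longlongrightarrow> 0) (at_right 0)"
        by (auto intro!: tendsto_eq_intros)
      show "\<forall>\<^sub>F t in at_right 0. \<bar>t\<bar> * euclid_norm d \<in> {0<..} \<and> \<bar>t\<bar> * euclid_norm d \<noteq> 0"
        using nd by (auto simp: eventually_at_filter)
    qed
    ultimately show "filterlim ((\<lambda>y. euclid_norm (y - x)) \<circ> (\<lambda>t. x + t \<cdot>\<^sub>v d)) (at_right 0) (at_right 0)"
      by (simp add: o_def)
    show "\<forall>\<^sub>F t in at_right 0. x + t \<cdot>\<^sub>v d \<in> carrier_vec N"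
      using x dN by simp
  qed
  have "(\<lambda>y. (f y - f x - h \<bullet> (y - x)) - (f y - f x - g \<bullet> (y - x)))
          \<in> o[vec_at N x](\<lambda>y. euclid_norm (y - x))"
    using g h unfolding has_gradient_def by (intro sum_in_smallo(2)[of "\<lambda>y. f y - f x - h \<bullet> (y - x)"]) blast+
  from landau_o.small.compose[OF this lim]
  have "(\<lambda>t. g \<bullet> (x + t \<cdot>\<^sub>v d - x) - h \<bullet> (x + t \<cdot>\<^sub>v d - x))
          \<in> o[at_right 0](\<lambda>t. euclid_norm (x + t \<cdot>\<^sub>v d - x))"
    by simp
  moreover have "x + t \<cdot>\<^sub>v d - x = t \<cdot>\<^sub>v d" for t
    using x dN by (intro eq_vecI) auto
  moreover have "g \<bullet> (t \<cdot>\<^sub>v d) - h \<bullet> (t \<cdot>\<^sub>v d) = t * (euclid_norm d)\<^sup>2" for t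
  proof -
    have "g \<bullet> (t \<cdot>\<^sub>v d) - h \<bullet> (t \<cdot>\<^sub>v d) = t * (d \<bullet> d)"
      unfolding d_def using gN hN
      by (simp add: minus_scalar_prod_distrib[of _ N] scalar_prod_minus_distrib[of _ N]
            algebra_simps)
    moreover have "d \<bullet> d \<ge> 0"
      by (simp add: scalar_prod_def sum_nonneg)
    ultimately show ?thesis by (simp add: euclid_norm_def)
  qed
  ultimately have "(\<lambda>t. t * (euclid_norm d)\<^sup>2) \<in> o[at_right 0](\<lambda>t. \<bar>t\<bar> * euclid_norm d)"
    by (simp add: euclid_norm_smult[OF dN])
  from landau_o.smallD[OF this, of "euclid_norm d / 2"] nd
  have "\<forall>\<^sub>F t in at_right 0. \<bar>t\<bar> * (euclid_norm d)\<^sup>2 \<le> euclid_norm d / 2 * (\<bar>t\<bar> * euclid_norm d)"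
    by (simp add: abs_mult)
  moreover have "\<forall>\<^sub>F t in at_right (0::real). t > 0"
    by (simp add: eventually_at_filter)
  ultimately have "\<forall>\<^sub>F t in at_right (0::real). False"
  proof eventually_elim
    case (elim t)
    hence "t * (euclid_norm d)\<^sup>2 \<le> t * ((euclid_norm d)\<^sup>2 / 2)"
      by (simp add: power2_eq_square algebra_simps)
    thus False using elim nd by simp
  qed
  thus False by simp
qed

lemma gradient_eqI:
  assumes "x \<in> carrier_vec N" "has_gradient N f g x"
  shows "gradient N f x = g"
  unfolding gradient_def using assms has_gradient_unique by (intro the_equality) blast+

lemma mat_inverse_damped_mat:
  assumes "sym_pos_def N (H \<theta>)" "l \<ge> 0"
  shows "\<exists>B. mat_inverse (damped_mat N l H \<theta>) = Some B \<and> B \<in> carrier_mat N N \<and>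
           damped_mat N l H \<theta> * B = 1\<^sub>m N \<and> B * damped_mat N l H \<theta> = 1\<^sub>m N"
proof -
  let ?A = "damped_mat N l H \<theta>"
  have HN: "H \<theta> \<in> carrier_mat N N" using assms by (simp add: sym_pos_def_def)
  hence A: "?A \<in> carrier_mat N N" by (simp add: damped_mat_def)
  have "det ?A \<noteq> 0"
  proof
    assume "det ?A = 0"
    then obtain v where v: "v \<in> carrier_vec N" "v \<noteq> 0\<^sub>v N" "?A *\<^sub>v v = 0\<^sub>v N"
      using det_0_iff_vec_prod_zero[OF A] by blast
    have "(l \<cdot>\<^sub>m 1\<^sub>m N) *\<^sub>v v = l \<cdot>\<^sub>v v"
    proof (rule eq_vecI)
      fix i assume "i < dim_vec (l \<cdot>\<^sub>v v)"
      hence i: "i < N" using v by simp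
      have "l * (if j = i then 1 else 0) * v $ j = (if j = i then l * v $ j else 0)" for j
        by simp
      thus "((l \<cdot>\<^sub>m 1\<^sub>m N) *\<^sub>v v) $ i = (l \<cdot>\<^sub>v v) $ i"
        using i v by (simp add: scalar_prod_def)
    qed (use v in simp)
    hence "?A *\<^sub>v v = H \<theta> *\<^sub>v v + l \<cdot>\<^sub>v v"
      using HN v by (simp add: damped_mat_def add_mult_distrib_mat_vec[of _ N N])
    hence "v \<bullet> (?A *\<^sub>v v) = v \<bullet> (H \<theta> *\<^sub>v v) + l * (v \<bullet> v)"
      using HN v by (simp add: scalar_prod_add_distrib[of _ N])
    moreover have "v \<bullet> (H \<theta> *\<^sub>v v) > 0" using assms v by (simp add: sym_pos_def_def)
    moreover have "v \<bullet> v \<ge> 0" by (simp add: scalar_prod_def sum_nonneg)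
    hence "l * (v \<bullet> v) \<ge> 0" using assms by simp
    ultimately show False using v by simp
  qed
  hence "?A \<in> Units (ring_mat TYPE(real) N ())"
    using det_non_zero_imp_unit[OF A] by simp
  then obtain B where "mat_inverse ?A = Some B"
    using mat_inverse(1)[OF A, where b = "()"] by (cases "mat_inverse ?A") auto
  thus ?thesis using mat_inverse(2)[OF A] by blast
qed

end

theory Submission
  imports Defs "HOL-Analysis.L2_Norm"
begin

text \<open>
  Write \<open>\<phi>\<^sub>t\<close> for the teacher, \<open>n\<^sub>t\<close> for the natural gradient with damping \<open>lam_bar\<close> at \<open>\<theta>\<^sub>t\<close> and \<open>r = 1 - \<eta>\<kappa>\<close>. If
  \<open>n\<^sub>t\<close> were constant, then \<open>\<theta>\<^sub>t - \<phi>\<^sub>t = - \<alpha> n\<close> and \<open>\<theta>\<^sub>t - \<theta>\<^sub>t\<^sub>-\<^sub>1 = - \<gamma> n\<close> would be a stationary regime of the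
  algorithm. The deviations \<open>x\<^sub>t = \<theta>\<^sub>t - \<phi>\<^sub>t + \<alpha> n\<^sub>t\<close> and \<open>y\<^sub>t = \<theta>\<^sub>t - \<theta>\<^sub>t\<^sub>-\<^sub>1 + \<gamma> n\<^sub>t\<close> obey a heavy ball recursion
  with forcing of size \<open>\<eta>\<alpha>\<^sup>2\<close>. In the coordinates \<open>x + a y\<close> and \<open>y\<close> (with \<open>a\<close> about \<open>\<mu> / (1 - \<mu>)\<close>)
  that recursion is almost triangular, and \<open>\<bar>x + a y\<bar> + b \<bar>y\<bar>\<close> contracts by \<open>1 - \<eta>\<kappa>/8\<close> at each step,
  whatever the matrices \<open>H(\<theta>\<^sub>t)\<close> are, as long as they are positive semidefinite and bounded; the
  contraction comes from the averaging, not from a lower bound on \<open>H\<close>. So the deviations start at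
  \<open>O(\<alpha>)\<close> and decay to \<open>O(\<alpha>\<^sup>2)\<close> after about \<open>ln (1/\<alpha>) / (\<eta>\<kappa>)\<close> steps. The teacher moves by \<open>- \<gamma> n\<^sub>t\<^sub>+\<^sub>1 + (\<gamma>/\<alpha>) x\<^sub>t\<^sub>+\<^sub>1\<close>, and these
  corrections add up to \<open>O(\<alpha>)\<close> over \<open>A/\<gamma>\<close> steps, so a Gronwall estimate gives an error \<open>O(\<alpha>)\<close>,
  which is at most \<open>O(\<alpha> ln (1/\<alpha>))\<close> as soon as \<open>\<alpha> \<le> exp (- 1)\<close>.
\<close>

section \<open>Euclidean and operator norms\<close>

lemma euclid_norm_zero [simp]: "euclid_norm (0\<^sub>v N) = 0"
  by (simp add: euclid_norm_def)

lemma euclid_norm_nonneg [simp]: "euclid_norm v \<ge> 0"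
  by (simp add: euclid_norm_def scalar_prod_def sum_nonneg)

lemma euclid_norm_power2: "(euclid_norm v)\<^sup>2 = v \<bullet> v"
  by (simp add: euclid_norm_def scalar_prod_def sum_nonneg)

lemma euclid_norm_eq_L2_set:
  assumes "v \<in> carrier_vec N"
  shows "euclid_norm v = L2_set (\<lambda>i. v $ i) {..<N}"
  using assms
  by (simp add: euclid_norm_def L2_set_def scalar_prod_def atLeast0LessThan power2_eq_square)

lemma euclid_norm_triangle:
  assumes "u \<in> carrier_vec N" "v \<in> carrier_vec N"
  shows "euclid_norm (u + v) \<le> euclid_norm u + euclid_norm v"
proof -
  have "L2_set (\<lambda>i. (u + v) $ i) {..<N} = L2_set (\<lambda>i. u $ i + v $ i) {..<N}"
    using assms by (intro L2_set_cong) auto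
  then show ?thesis
    using assms L2_set_triangle_ineq[of "\<lambda>i. u $ i" "\<lambda>i. v $ i" "{..<N}"]
    by (simp add: euclid_norm_eq_L2_set[of _ N])
qed

lemma euclid_norm_triangle_minus:
  assumes "u \<in> carrier_vec N" "v \<in> carrier_vec N"
  shows "euclid_norm (u - v) \<le> euclid_norm u + euclid_norm v"
proof -
  have "u - v = u + (-1) \<cdot>\<^sub>v v" using assms by (intro eq_vecI) auto
  then show ?thesis
    using assms euclid_norm_triangle[of u N "(-1) \<cdot>\<^sub>v v"] euclid_norm_smult[of v N "-1"] by simp
qed

text \<open>Every update estimated below is a combination of at most four vectors, so this one form
  of the triangle inequality serves them all.\<close>

lemma euclid_norm_combination4:
  assumes "u1 \<in> carrier_vec N" "u2 \<in> carrier_vec N" "u3 \<in> carrier_vec N" "u4 \<in> carrier_vec N"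
  shows "euclid_norm (c1 \<cdot>\<^sub>v u1 + c2 \<cdot>\<^sub>v u2 + c3 \<cdot>\<^sub>v u3 + c4 \<cdot>\<^sub>v u4) \<le>
    \<bar>c1\<bar> * euclid_norm u1 + \<bar>c2\<bar> * euclid_norm u2 + \<bar>c3\<bar> * euclid_norm u3 + \<bar>c4\<bar> * euclid_norm u4"
proof -
  note c = smult_carrier_vec add_carrier_vec assms
  have "euclid_norm (c1 \<cdot>\<^sub>v u1 + c2 \<cdot>\<^sub>v u2 + c3 \<cdot>\<^sub>v u3 + c4 \<cdot>\<^sub>v u4) \<le>
    euclid_norm (c1 \<cdot>\<^sub>v u1) + euclid_norm (c2 \<cdot>\<^sub>v u2) + euclid_norm (c3 \<cdot>\<^sub>v u3) + euclid_norm (c4 \<cdot>\<^sub>v u4)"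
    using assms
    by (intro order_trans[OF euclid_norm_triangle[of _ N]] add_mono order_refl) auto
  then show ?thesis using assms by (simp add: euclid_norm_smult)
qed

text \<open>The crude bound by the sum of the absolute values of the entries suffices: its main use
  is to show that the supremum in \<open>op_norm\<close> is taken over a set bounded above.\<close>

lemma mult_mat_vec_bounded:
  fixes M :: "real mat"
  assumes M: "M \<in> carrier_mat N N"
  shows "\<exists>C. \<forall>x\<in>carrier_vec N. euclid_norm (M *\<^sub>v x) \<le> C * euclid_norm x"
proof (intro exI ballI)
  fix x :: "real vec" assume x: "x \<in> carrier_vec N"
  have xj: "\<bar>x $ j\<bar> \<le> euclid_norm x" if "j < N" for j
  proof -
    have "\<bar>x $ j\<bar> \<le> L2_set (\<lambda>i. \<bar>x $ i\<bar>) {..<N}" using that by (intro member_le_L2_set) auto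
    then show ?thesis using x by (simp add: euclid_norm_eq_L2_set L2_set_def)
  qed
  have "euclid_norm (M *\<^sub>v x) \<le> (\<Sum>i<N. \<bar>(M *\<^sub>v x) $ i\<bar>)"
    using M x 
    by (subst euclid_norm_eq_L2_set[of _ N]) (simp_all only: mult_mat_vec_carrier L2_set_le_sum_abs)
  also have "\<dots> \<le> (\<Sum>i<N. \<Sum>j<N. \<bar>M $$ (i, j)\<bar> * euclid_norm x)"
  proof (intro sum_mono)
    fix i assume "i \<in> {..<N}"
    then have "(M *\<^sub>v x) $ i = (\<Sum>j<N. M $$ (i, j) * x $ j)"
      using M x by (simp add: scalar_prod_def atLeast0LessThan)
    also have "\<bar>\<dots>\<bar> \<le> (\<Sum>j<N. \<bar>M $$ (i, j) * x $ j\<bar>)" by (rule sum_abs)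
    also have "\<dots> \<le> (\<Sum>j<N. \<bar>M $$ (i, j)\<bar> * euclid_norm x)"
      using xj by (intro sum_mono) (auto simp: abs_mult intro: mult_left_mono)
    finally show "\<bar>(M *\<^sub>v x) $ i\<bar> \<le> (\<Sum>j<N. \<bar>M $$ (i, j)\<bar> * euclid_norm x)" .
  qed
  also have "\<dots> = (\<Sum>i<N. \<Sum>j<N. \<bar>M $$ (i, j)\<bar>) * euclid_norm x"
    by (simp add: sum_distrib_right)
  finally show "euclid_norm (M *\<^sub>v x) \<le> (\<Sum>i<N. \<Sum>j<N. \<bar>M $$ (i, j)\<bar>) * euclid_norm x" .
qed

lemma euclid_norm_mult_mat_vec_le:
  assumes M: "M \<in> carrier_mat N N" and K: "op_norm M \<le> K" and x: "x \<in> carrier_vec N"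
  shows "euclid_norm (M *\<^sub>v x) \<le> K * euclid_norm x"
proof (cases "x = 0\<^sub>v N")
  case True
  obtain C where "\<forall>x\<in>carrier_vec N. euclid_norm (M *\<^sub>v x) \<le> C * euclid_norm x"
    using mult_mat_vec_bounded[OF M] by blast
  then have "euclid_norm (M *\<^sub>v x) \<le> C * euclid_norm x" using x by blast
  then show ?thesis by (simp add: True)
next
  case False
  then have nx: "euclid_norm x > 0" using euclid_norm_pos x by blast
  obtain C where C: "\<And>y. y\<in>carrier_vec N \<Longrightarrow> euclid_norm (M *\<^sub>v y) \<le> C * euclid_norm y"
    using mult_mat_vec_bounded[OF M] by blast
  \<comment> \<open>A vector \<open>y\<close> of norm zero contributes the quotient 0, which
    \<open>C\<close> bounds only if it is nonnegative; hence the maximum.\<close>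
  have "euclid_norm (M *\<^sub>v y) / euclid_norm y \<le> max C 0" if "y \<in> carrier_vec N" for y
  proof (cases "euclid_norm y = 0")
    case True
    then show ?thesis by simp
  next
    case False
    then have "euclid_norm y > 0" using euclid_norm_nonneg[of y] by linarith
    then have "euclid_norm (M *\<^sub>v y) / euclid_norm y \<le> C" 
      using C[OF that] by (simp add: field_simps)
    then show ?thesis by simp
  qed
  then have "bdd_above ((\<lambda>y. euclid_norm (M *\<^sub>v y) / euclid_norm y) ` carrier_vec N)"
    by (intro bdd_aboveI2)
  then have "euclid_norm (M *\<^sub>v x) / euclid_norm x \<le> op_norm M"
    using M x unfolding op_norm_def by (intro cSUP_upper) auto
  then have "euclid_norm (M *\<^sub>v x) / euclid_norm x \<le> K" using K by linarith
  then show ?thesis using nx by (simp add: pos_divide_le_eq)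
qed

text \<open>When the square is expanded, the cross term has the favourable sign, so \<open>w\<close>
  costs only the second-order term \<open>\<tau>\<^sup>2 * K\<^sup>2\<close>. Below,
  \<open>\<tau>\<close> is of order \<eta>, and the cost is covered by the first-order gain in
  \<open>r\<close>.\<close>

lemma euclid_norm_minus_psd_le:
  assumes z: "z \<in> carrier_vec N" and w: "w \<in> carrier_vec N"
    and zw: "z \<bullet> w \<ge> 0" and wK: "euclid_norm w \<le> K * euclid_norm z"
    and "0 \<le> r" "0 \<le> \<tau>" "0 \<le> \<rho>" "r\<^sup>2 + \<tau>\<^sup>2 * K\<^sup>2 \<le> \<rho>\<^sup>2"
  shows "euclid_norm (r \<cdot>\<^sub>v z - \<tau> \<cdot>\<^sub>v w) \<le> \<rho> * euclid_norm z"
proof (rule power2_le_imp_le)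
  have "(euclid_norm (r \<cdot>\<^sub>v z - \<tau> \<cdot>\<^sub>v w))\<^sup>2 = 
      r\<^sup>2 * (euclid_norm z)\<^sup>2 - 2 * r * \<tau> * (z \<bullet> w) + \<tau>\<^sup>2 * (euclid_norm w)\<^sup>2"
    unfolding euclid_norm_power2 using z w
    by (simp add: scalar_prod_def sum_distrib_left power2_eq_square flip: sum_subtractf sum.distrib)
       (auto intro!: sum.cong simp: algebra_simps)
  also have "\<dots> \<le> r\<^sup>2 * (euclid_norm z)\<^sup>2 + \<tau>\<^sup>2 * (K * euclid_norm z)\<^sup>2"
  proof -
    have "\<tau>\<^sup>2 * (euclid_norm w)\<^sup>2 \<le> \<tau>\<^sup>2 * (K * euclid_norm z)\<^sup>2"
      using wK by (intro mult_left_mono power_mono) auto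
    moreover have "0 \<le> 2 * r * \<tau> * (z \<bullet> w)" using assms by simp
    ultimately show ?thesis by linarith
  qed
  also have "\<dots> = (r\<^sup>2 + \<tau>\<^sup>2 * K\<^sup>2) * (euclid_norm z)\<^sup>2" by (simp add: algebra_simps power_mult_distrib)
  also have "\<dots> \<le> \<rho>\<^sup>2 * (euclid_norm z)\<^sup>2" using assms by (intro mult_right_mono) auto
  finally show "(euclid_norm (r \<cdot>\<^sub>v z - \<tau> \<cdot>\<^sub>v w))\<^sup>2 \<le> (\<rho> * euclid_norm z)\<^sup>2"
    by (simp add: power_mult_distrib)
qed (use assms in simp)

section \<open>Gradients and damped matrices\<close>

lemma has_gradient_add:
  assumes "x \<in> carrier_vec N" "has_gradient N f g x" "has_gradient N f' g' x"
  shows "has_gradient N (\<lambda>y. f y + f' y) (g + g') x"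
proof -
  have g: "g \<in> carrier_vec N" "g' \<in> carrier_vec N" using assms by (auto simp: has_gradient_def)
  have "(\<lambda>y. (f y - f x - g \<bullet> (y - x)) + (f' y - f' x - g' \<bullet> (y - x)))
          \<in> o[vec_at N x](\<lambda>y. euclid_norm (y - x))"
    using assms unfolding has_gradient_def by (intro sum_in_smallo(1)) blast+
  moreover have "(g + g') \<bullet> (y - x) = g \<bullet> (y - x) + g' \<bullet> (y - x)" if "y \<in> carrier_vec N" for y
    using that g assms(1) by (intro add_scalar_prod_distrib[of _ N]) auto
  \<comment> \<open>Inner products distribute only over vectors of length \<open>N\<close>, so the
    two remainders agree only eventually along the filter, which is enough for little-o.\<close>
  moreover have "\<forall>\<^sub>F y in vec_at N x. y \<in> carrier_vec N"
    by (auto simp: vec_at_def eventually_inf_principal)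
  ultimately have "(\<lambda>y. f y + f' y - (f x + f' x) - (g + g') \<bullet> (y - x))
          \<in> o[vec_at N x](\<lambda>y. euclid_norm (y - x))"
    by (elim landau_o.small.in_cong[THEN iffD1, rotated])
       (auto elim!: eventually_mono simp: algebra_simps)
  then show ?thesis using g by (simp add: has_gradient_def)
qed

lemma has_gradient_cmult:
  assumes "x \<in> carrier_vec N" "has_gradient N f g x"
  shows "has_gradient N (\<lambda>y. c * f y) (c \<cdot>\<^sub>v g) x"
proof -
  have g: "g \<in> carrier_vec N" using assms by (auto simp: has_gradient_def)
  have "(\<lambda>y. c * (f y - f x - g \<bullet> (y - x))) \<in> o[vec_at N x](\<lambda>y. euclid_norm (y - x))"
    using assms unfolding has_gradient_def by (cases "c = 0") auto
  moreover have "(c \<cdot>\<^sub>v g) \<bullet> (y - x) = c * (g \<bullet> (y - x))" for y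
    using g assms(1) by (simp add: carrier_vecD)
  ultimately show ?thesis using g by (simp add: has_gradient_def algebra_simps)
qed

text \<open>The first-order remainder is exactly half the squared distance from \<open>y\<close> to
  \<open>x\<close>; it is negligible because \<open>t * t\<close> is little-o of \<open>t\<close> at
  0, pulled back along the distance.\<close>

lemma has_gradient_half_norm_square:
  assumes x: "x \<in> carrier_vec N" and p: "p \<in> carrier_vec N"
  shows "has_gradient N (\<lambda>y. 1 / 2 * (euclid_norm (y - p))\<^sup>2) (x - p) x"
proof -
  let ?F = "vec_at N x"
  have lim: "filterlim (\<lambda>y. euclid_norm (y - x)) (at_right 0) ?F"
    unfolding vec_at_def 
    by (rule filterlim_mono[OF filterlim_filtercomap order_refl inf_le1])
  have "(\<lambda>t::real. t * t) \<in> o[at_right 0](\<lambda>t. t)"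
  proof (rule landau_o.smallI)
    fix c :: real assume "c > 0"
    then show "\<forall>\<^sub>F t::real in at_right 0. norm (t * t) \<le> c * norm t"
      by (auto simp: eventually_at_right_field abs_mult intro!: exI[of _ c])
  qed
  from landau_o.small.compose[OF this lim]
  have "(\<lambda>y. 1 / 2 * (euclid_norm (y - x) * euclid_norm (y - x))) \<in> o[?F](\<lambda>y. euclid_norm (y - x))"
    by simp
  moreover have "1 / 2 * (euclid_norm (y - p))\<^sup>2 - 1 / 2 * (euclid_norm (x - p))\<^sup>2 - (x - p) \<bullet> (y - x)
      = 1 / 2 * (euclid_norm (y - x) * euclid_norm (y - x))" if "y \<in> carrier_vec N" for y
  proof -
    have "(y - p) \<bullet> (y - p) = (x - p) \<bullet> (x - p) + 2 * ((x - p) \<bullet> (y - x)) + (y - x) \<bullet> (y - x)"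
      using that x p by (simp add: scalar_prod_def sum_distrib_left flip: sum.distrib)
        (auto intro!: sum.cong simp: algebra_simps)
    then show ?thesis
      unfolding power2_eq_square[symmetric] euclid_norm_power2 by (simp add: field_simps)
  qed
  moreover have "\<forall>\<^sub>F y in ?F. y \<in> carrier_vec N"
    by (auto simp: vec_at_def eventually_inf_principal)
  ultimately have "(\<lambda>y. 1 / 2 * (euclid_norm (y - p))\<^sup>2 - 1 / 2 * (euclid_norm (x - p))\<^sup>2 - (x - p) \<bullet> (y - x))
      \<in> o[?F](\<lambda>y. euclid_norm (y - x))"
    by (elim landau_o.small.in_cong[THEN iffD1, rotated]) (auto elim!: eventually_mono)
  then show ?thesis using x p by (simp add: has_gradient_def)
qed

lemma has_gradient_gradient:
  assumes "differentiable_vec N f" "x \<in> carrier_vec N"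
  shows "has_gradient N f (gradient N f x) x"
  using assms gradient_eqI unfolding differentiable_vec_def by metis

text \<open>Since \<open>gradient\<close> is a definite description, the sum rule is proved for
  \<open>has_gradient\<close> and transferred by uniqueness.\<close>

lemma gradient_damped_objective:
  assumes "differentiable_vec N L" "differentiable_vec N (\<lambda>y. D y p)"
    and x: "x \<in> carrier_vec N" and p: "p \<in> carrier_vec N"
  shows "gradient N (\<lambda>y. \<alpha> * L y + damped_div l D y p) x =
    \<alpha> \<cdot>\<^sub>v gradient N L x + (gradient N (\<lambda>y. D y p) x + l \<cdot>\<^sub>v (x - p))"
proof (rule gradient_eqI[OF x])
  have "has_gradient N (\<lambda>y. \<alpha> * L y + (D y p + l * (1 / 2 * (euclid_norm (y - p))\<^sup>2)))
    (\<alpha> \<cdot>\<^sub>v gradient N L x + (gradient N (\<lambda>y. D y p) x + l \<cdot>\<^sub>v (x - p))) x"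
    by (intro has_gradient_add has_gradient_cmult has_gradient_gradient
        has_gradient_half_norm_square x p assms)
  then show "has_gradient N (\<lambda>y. \<alpha> * L y + damped_div l D y p)
    (\<alpha> \<cdot>\<^sub>v gradient N L x + (gradient N (\<lambda>y. D y p) x + l \<cdot>\<^sub>v (x - p))) x"
    by (simp add: damped_div_def)
qed

lemma damped_mat_carrier:
  assumes "H \<theta> \<in> carrier_mat N N"
  shows "damped_mat N l H \<theta> \<in> carrier_mat N N"
  using assms by (simp add: damped_mat_def)

lemma damped_mat_mult_vec:
  assumes "H \<theta> \<in> carrier_mat N N" "v \<in> carrier_vec N"
  shows "damped_mat N l H \<theta> *\<^sub>v v = H \<theta> *\<^sub>v v + l \<cdot>\<^sub>v v"
proof -
  have "(l \<cdot>\<^sub>m 1\<^sub>m N) *\<^sub>v v = l \<cdot>\<^sub>v v"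
  proof (rule eq_vecI)
    fix i assume "i < dim_vec (l \<cdot>\<^sub>v v)"
    then have i: "i < N" using assms by simp
    have "row (l \<cdot>\<^sub>m 1\<^sub>m N) i = l \<cdot>\<^sub>v unit_vec N i" using i by (intro eq_vecI) auto
    then show "((l \<cdot>\<^sub>m 1\<^sub>m N) *\<^sub>v v) $ i = (l \<cdot>\<^sub>v v) $ i" using i assms by simp
  qed (use assms in simp)
  then show ?thesis
    using assms by (simp add: damped_mat_def add_mult_distrib_mat_vec[of _ N N])
qed

lemma natural_grad_carrier:
  assumes "sym_pos_def N (H \<theta>)" "l \<ge> 0" "gradient N L \<theta> \<in> carrier_vec N"
  shows "natural_grad N l L H \<theta> \<in> carrier_vec N"
  using mat_inverse_damped_mat[of N H \<theta> l] assms by (auto simp: natural_grad_def)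

text \<open>This removes the inverse from the recursion: the gradient of \<open>L\<close> can be
  replaced by a matrix acting on the natural gradient.\<close>

lemma damped_mat_natural_grad:
  assumes spd: "sym_pos_def N (H \<theta>)" and l: "l \<ge> 0" and grad: "gradient N L \<theta> \<in> carrier_vec N"
  shows "damped_mat N l H \<theta> *\<^sub>v natural_grad N l L H \<theta> = gradient N L \<theta>"
proof -
  obtain P where P: "mat_inverse (damped_mat N l H \<theta>) = Some P" "P \<in> carrier_mat N N"
    "damped_mat N l H \<theta> * P = 1\<^sub>m N"
    using mat_inverse_damped_mat[of N H \<theta> l] spd l by blast
  have "damped_mat N l H \<theta> \<in> carrier_mat N N"
    using spd by (simp add: damped_mat_carrier sym_pos_def_def)
  then have "damped_mat N l H \<theta> *\<^sub>v (P *\<^sub>v gradient N L \<theta>) = (damped_mat N l H \<theta> * P) *\<^sub>v gradient N L \<theta>"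
    
    using P grad by (intro assoc_mult_mat_vec[symmetric])
  then show ?thesis using P grad by (simp add: natural_grad_def)
qed

lemma damped_mat_psd:
  assumes "sym_pos_def N (H \<theta>)" "l \<ge> 0" "v \<in> carrier_vec N"
  shows "v \<bullet> (damped_mat N l H \<theta> *\<^sub>v v) \<ge> 0"
proof -
  have H: "H \<theta> \<in> carrier_mat N N" using assms by (simp add: sym_pos_def_def)
  have "v \<bullet> (damped_mat N l H \<theta> *\<^sub>v v) = v \<bullet> (H \<theta> *\<^sub>v v) + l * (v \<bullet> v)"
    using H assms by (simp add: damped_mat_mult_vec scalar_prod_add_distrib[of _ N])
  moreover have "v \<bullet> (H \<theta> *\<^sub>v v) \<ge> 0"
    using assms H by (cases "v = 0\<^sub>v N") (auto simp: sym_pos_def_def less_imp_le)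
  moreover have "v \<bullet> v \<ge> 0" by (simp flip: euclid_norm_power2)
  ultimately show ?thesis using assms by simp
qed

section \<open>Contraction of the heavy ball recursion\<close>

text \<open>Each forcing \<open>p\<close> may be multiplied by \<open>(1 + q) ^ Suc t\<close>, which
  is at least 1. This gives a bound linear in \<open>t * p\<close>, without a division by
  \<open>q\<close>.\<close>

lemma discrete_gronwall:
  fixes f :: "nat \<Rightarrow> real"
  assumes step: "\<And>t. f (Suc t) \<le> (1 + q) * f t + p" and "0 \<le> q" "0 \<le> p" "0 \<le> f 0"
  shows "f t \<le> (1 + q) ^ t * (f 0 + real t * p)"
proof (induction t)
  case (Suc t)
  have "1 \<le> (1 + q) ^ Suc t" using assms by (intro one_le_power) simp
  then have "p \<le> (1 + q) ^ Suc t * p" using assms mult_right_mono[of 1 _ p] by simp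
  moreover have "(1 + q) * f t \<le> (1 + q) * ((1 + q) ^ t * (f 0 + real t * p))"
    using Suc assms by (intro mult_left_mono) auto
  ultimately show ?case using step[of t] by (simp add: algebra_simps)
qed simp

text \<open>Everything defined here depends on \<kappa>, \<mu> and \<open>K\<close> alone, which
  makes the final constants uniform in \<alpha>, \<eta>, the dimension and the functions.\<close>

locale drift_constants =
  fixes \<kappa> \<mu> K :: real
  assumes kappa_pos: "\<kappa> > 0" and mu_nonneg: "0 \<le> \<mu>" and mu_less_1: "\<mu> < 1" and K_ge_1: "K \<ge> 1"
begin

text \<open>
  \<open>S\<close> bounds the coefficients \<open>a\<close> and \<open>r + a\<close> of the change of coordinates below; \<open>b\<close> is the weight of \<open>y\<close>
  in the Lyapunov function \<open>E = \<bar>x + a y\<bar> + b \<bar>y\<bar>\<close>, small enough that \<open>b \<eta> K \<le> \<eta>\<kappa>/4\<close>; \<open>\<bar>x\<bar> \<le> G E\<close>; below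
  the threshold \<open>\<epsilon>\<close> the quadratic error of the divergence is absorbed by the contraction; \<open>C1 \<eta> \<alpha>\<^sup>2\<close> is
  the remaining forcing and \<open>B \<alpha>\<close> the resulting invariant bound on \<open>E\<close>.
\<close>

definition "S = 2 / (1 - \<mu>)"
definition "b = \<kappa> / (4 * K)"
definition "G = 1 + S / b"
definition "J = S + b + 1"
definition "\<epsilon> = \<kappa> / (32 * K * G\<^sup>2 * (J * (1 + K)))"
definition "C1 = 2 * (J * (1 + K)) * K ^ 3 + 2 * \<kappa> * (J * K\<^sup>2)"
definition "B = J * K + 8 * C1 / \<kappa>"
text \<open>\<open>c\<close> turns the terms in \<open>x\<close> of the teacher's error into a
  multiple of \<open>E\<close>; \<open>C2\<close> is the forcing per unit of
  \<open>\<gamma> * \<alpha>\<close> that then remains.\<close>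

definition "c = (2 * K + 1) * G"
definition "C2 = 2 * K\<^sup>2 + 32 * c * C1 / \<kappa>"

lemma const_pos:
  "S > 0" "b > 0" "G \<ge> 1" "J > 1" "\<epsilon> > 0" "C1 > 0" "B > 0" "c > 0" "C2 > 0" "S + b \<le> J"
proof -
  show S: "S > 0" using mu_less_1 by (simp add: S_def)
  show b: "b > 0" using kappa_pos K_ge_1 by (simp add: b_def)
  show G: "G \<ge> 1" using S b by (simp add: G_def)
  show J: "J > 1" using S b by (simp add: J_def)
  show "\<epsilon> > 0" using kappa_pos K_ge_1 G J by (simp add: \<epsilon>_def)
  show C1: "C1 > 0" using kappa_pos K_ge_1 J unfolding C1_def by (intro add_pos_pos mult_pos_pos) auto
  show "B > 0" using kappa_pos K_ge_1 J C1 by (simp add: B_def add_pos_pos)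
  show c: "c > 0" using G K_ge_1 by (simp add: c_def)
  show "C2 > 0" using kappa_pos K_ge_1 c C1 by (simp add: C2_def add_pos_pos)
  show "S + b \<le> J" by (simp add: J_def)
qed

end

text \<open>\<open>alpha_J\<close> and \<open>alpha_JG\<close> absorb the feedback from the change
  of the natural gradient, \<open>alpha_B\<close> keeps \<open>E\<close> below
  \<open>\<epsilon>\<close>, \<open>eta_kappa\<close> separates \<open>r\<close> from \<mu>, and
  \<open>eta_S\<close> and \<open>eta_b\<close> leave room for the contraction of
  \<open>x + a y\<close> and of \<open>y\<close>. No condition mixes \<alpha> and \<eta>, so their
  thresholds can be chosen separately.\<close>

locale small_rates = drift_constants +
  fixes \<alpha> \<eta> :: real
  assumes alpha_pos: "0 < \<alpha>" and alpha_le_1: "\<alpha> \<le> 1" and eta_pos: "0 < \<eta>"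
    and alpha_J: "\<alpha> * (J * K) \<le> b * (1 - \<mu>) / 2"
    and alpha_JG: "\<alpha> * (J * K\<^sup>2 * G) \<le> \<kappa> / 16"
    and alpha_B: "B * \<alpha> \<le> \<epsilon>"
    and eta_kappa: "\<eta> * \<kappa> \<le> (1 - \<mu>) / 2"
    and eta_S: "\<eta> * (\<kappa>\<^sup>2 + S\<^sup>2 * K\<^sup>2) \<le> \<kappa>"
    and eta_b: "\<eta> * (S\<^sup>2 * K + b * K * S + b * \<kappa> / 4) \<le> b * (1 - \<mu>) / 2"
begin

definition "r = 1 - \<eta> * \<kappa>"
definition "\<gamma> = \<kappa> * \<alpha> * \<eta> / (1 - \<kappa> * \<eta>)"

lemma r_bounds: "r \<ge> 1 / 2" "r < 1" "r - \<mu> \<ge> (1 - \<mu>) / 2"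
proof -
  show "r \<ge> 1 / 2" using eta_kappa mu_nonneg by (simp add: r_def)
  show "r < 1" using eta_pos kappa_pos by (simp add: r_def)
  show "r - \<mu> \<ge> (1 - \<mu>) / 2" using eta_kappa by (simp add: r_def field_simps)
qed

lemma gamma_eq: "\<gamma> * r = \<kappa> * \<alpha> * \<eta>"
  using r_bounds by (simp add: \<gamma>_def r_def mult.commute)

text \<open>All follow from \<open>gamma_eq\<close> and \<open>r\<close> lying between 1/2 and 1.
  The last bound measures the forcing per step in units of \<gamma>, so that
  \<open>A / \<gamma>\<close> steps accumulate only O(\<alpha>).\<close>

lemma gamma_bounds: "\<gamma> > 0" "\<gamma> \<le> 2 * \<kappa> * \<eta> * \<alpha>" "\<gamma> \<le> \<alpha>" "\<eta> * \<alpha>\<^sup>2 \<le> \<gamma> * \<alpha> / \<kappa>"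
proof -
  show pos: "\<gamma> > 0"
    using kappa_pos alpha_pos eta_pos r_bounds unfolding \<gamma>_def r_def
    by (intro divide_pos_pos mult_pos_pos) (auto simp: mult.commute)
  have "\<gamma> * (1 / 2) \<le> \<gamma> * r" using pos r_bounds by (intro mult_left_mono) auto
  then show *: "\<gamma> \<le> 2 * \<kappa> * \<eta> * \<alpha>" unfolding gamma_eq by (simp add: algebra_simps)
  have "(2 * (\<eta> * \<kappa>)) * \<alpha> \<le> 1 * \<alpha>"
    using alpha_pos eta_kappa mu_nonneg by (intro mult_right_mono) auto
  with * show "\<gamma> \<le> \<alpha>" by (simp add: ac_simps)
  have "\<eta> * \<alpha>\<^sup>2 = \<gamma> * r * \<alpha> / \<kappa>"
    using kappa_pos by (simp add: gamma_eq power2_eq_square)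
  also have "\<dots> \<le> \<gamma> * 1 * \<alpha> / \<kappa>"
    using kappa_pos alpha_pos pos r_bounds
    by (intro divide_right_mono mult_right_mono mult_left_mono) auto
  finally show "\<eta> * \<alpha>\<^sup>2 \<le> \<gamma> * \<alpha> / \<kappa>" by simp
qed

text \<open>With this \<open>a\<close>, \<open>(r + a) \<mu> = r a\<close>, so \<open>x + a y\<close> is multiplied by \<open>r\<close> when the gradient vanishes.\<close>

definition "a = r * \<mu> / (r - \<mu>)"

lemma a_bounds: "0 \<le> a" "a \<le> S" "r + a \<le> S" "(r + a) * \<mu> = r * a"
proof -
  have d: "r - \<mu> > 0" using r_bounds mu_less_1 by (simp add: field_simps)
  show "0 \<le> a" using d r_bounds mu_nonneg by (simp add: a_def)
  \<comment> \<open>In this closed form the identity with \<mu> is immediate, and \<open>S\<close>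
    arises from \<open>r < 1\<close> and \<open>r - \<mu> \<ge> (1 - \<mu>) / 2\<close>.\<close>
  have ra: "r + a = r * r / (r - \<mu>)" using d by (simp add: a_def field_simps)
  then show "(r + a) * \<mu> = r * a" by (simp add: a_def)
  have "r * r \<le> 1 * 1" using r_bounds by (intro mult_mono) auto
  then have "r * r / (r - \<mu>) \<le> 1 / ((1 - \<mu>) / 2)"
    using d r_bounds mu_less_1 by (intro frac_le) auto
  then show "r + a \<le> S" by (simp add: ra S_def)
  then show "a \<le> S" using r_bounds by simp
qed

text \<open>In the coordinate \<open>z = x + a y\<close> the step acts as \<open>r\<close> minus
  \<open>(r + a) * \<eta>\<close> times \<open>M\<close>, which contracts by positive
  semidefiniteness. The variable \<open>y\<close> enters \<open>z\<close> only with a factor \<eta>,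
  and is itself damped by the momentum \<mu>.\<close>

lemma heavy_ball_step:
  assumes M: "M \<in> carrier_mat N N"
    and psd: "\<And>v. v \<in> carrier_vec N \<Longrightarrow> v \<bullet> (M *\<^sub>v v) \<ge> 0"
    and MK: "\<And>v. v \<in> carrier_vec N \<Longrightarrow> euclid_norm (M *\<^sub>v v) \<le> K * euclid_norm v"
    and c: "x \<in> carrier_vec N" "y \<in> carrier_vec N" "e \<in> carrier_vec N" "\<nu> \<in> carrier_vec N"
    and y': "y' = \<mu> \<cdot>\<^sub>v y - \<eta> \<cdot>\<^sub>v (M *\<^sub>v x) - \<eta> \<cdot>\<^sub>v e + \<gamma> \<cdot>\<^sub>v \<nu>"
    and x': "x' = r \<cdot>\<^sub>v (x + y' + \<alpha> \<cdot>\<^sub>v \<nu>)"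
  shows "euclid_norm (x' + a \<cdot>\<^sub>v y') \<le> (1 - \<eta> * \<kappa> / 2) * euclid_norm (x + a \<cdot>\<^sub>v y)
      + \<eta> * S\<^sup>2 * K * euclid_norm y + S * \<eta> * euclid_norm e + (S * \<gamma> + \<alpha>) * euclid_norm \<nu>"
    and "euclid_norm y' \<le> \<mu> * euclid_norm y + \<eta> * K * euclid_norm x + \<eta> * euclid_norm e + \<gamma> * euclid_norm \<nu>"
proof -
  note pos = kappa_pos alpha_pos eta_pos gamma_bounds(1) a_bounds r_bounds const_pos
  define s where "s = r + a"
  define p where "p = M *\<^sub>v x"
  define q where "q = M *\<^sub>v y"
  define z where "z = x + a \<cdot>\<^sub>v y"
  define w where "w = M *\<^sub>v z"
  have c': "p \<in> carrier_vec N" "q \<in> carrier_vec N" "z \<in> carrier_vec N" "w \<in> carrier_vec N"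
    using c M by (auto simp: p_def q_def z_def w_def)
  have w: "w = p + a \<cdot>\<^sub>v q"
    using c M by (simp add: w_def z_def p_def q_def mult_add_distrib_mat_vec[of _ N N] mult_mat_vec[of _ N N])
  have "y' = \<mu> \<cdot>\<^sub>v y + (- \<eta>) \<cdot>\<^sub>v p + (- \<eta>) \<cdot>\<^sub>v e + \<gamma> \<cdot>\<^sub>v \<nu>"
    unfolding y' p_def[symmetric] using c c' by (intro eq_vecI) auto
  then have "euclid_norm y' \<le> \<mu> * euclid_norm y + \<eta> * euclid_norm p + \<eta> * euclid_norm e + \<gamma> * euclid_norm \<nu>"
    using euclid_norm_combination4[of y N p e \<nu> \<mu> "- \<eta>" "- \<eta>" \<gamma>] c c' pos mu_nonneg by simp
  moreover have "\<eta> * euclid_norm p \<le> \<eta> * (K * euclid_norm x)"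
    unfolding p_def using pos c by (intro mult_left_mono MK) auto
  ultimately show "euclid_norm y' \<le> \<mu> * euclid_norm y + \<eta> * K * euclid_norm x + \<eta> * euclid_norm e + \<gamma> * euclid_norm \<nu>"
    by simp

  have ident: "x' + a \<cdot>\<^sub>v y' = 1 \<cdot>\<^sub>v (r \<cdot>\<^sub>v z - (s * \<eta>) \<cdot>\<^sub>v w) + (s * \<eta> * a) \<cdot>\<^sub>v q + (- (s * \<eta>)) \<cdot>\<^sub>v e
      + (s * \<gamma> + r * \<alpha>) \<cdot>\<^sub>v \<nu>"
  proof (rule eq_vecI)
    fix i assume "i < dim_vec (1 \<cdot>\<^sub>v (r \<cdot>\<^sub>v z - (s * \<eta>) \<cdot>\<^sub>v w) + (s * \<eta> * a) \<cdot>\<^sub>v q + (- (s * \<eta>)) \<cdot>\<^sub>v e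
      + (s * \<gamma> + r * \<alpha>) \<cdot>\<^sub>v \<nu>)"
    then have i: "i < N" using c by simp
    \<comment> \<open>By the choice of \<open>a\<close>, the momentum contribution
      \<open>(r + a) * \<mu>\<close> times \<open>y\<close> is exactly the \<open>y\<close> part of
      \<open>r\<close> times \<open>z\<close>.\<close>
    have "r * \<mu> + a * \<mu> = r * a" using a_bounds(4) by (simp add: algebra_simps)
    then have "r * (\<mu> * y $ i) + a * (\<mu> * y $ i) = r * (a * y $ i)"
      by (metis (no_types) distrib_right mult.assoc)
    then show "(x' + a \<cdot>\<^sub>v y') $ i = (1 \<cdot>\<^sub>v (r \<cdot>\<^sub>v z - (s * \<eta>) \<cdot>\<^sub>v w) + (s * \<eta> * a) \<cdot>\<^sub>v q + (- (s * \<eta>)) \<cdot>\<^sub>v e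
      + (s * \<gamma> + r * \<alpha>) \<cdot>\<^sub>v \<nu>) $ i"
      unfolding x' y' p_def[symmetric] z_def w s_def using c c' i by (simp add: algebra_simps)
  qed (use c c' in \<open>simp add: x' y'\<close>)
  have "euclid_norm (r \<cdot>\<^sub>v z - (s * \<eta>) \<cdot>\<^sub>v w) \<le> (1 - \<eta> * \<kappa> / 2) * euclid_norm z"
  proof (rule euclid_norm_minus_psd_le)
    \<comment> \<open>Expanding \<open>r\<^sup>2\<close> gains \<open>2 * \<eta> * \<kappa>\<close>;
      by \<open>eta_S\<close> the quadratic terms use up at most half of it, and the rest pays for
      the factor \<open>1 - \<eta> * \<kappa> / 2\<close>.\<close>
    have "s\<^sup>2 \<le> S\<^sup>2" using pos by (intro power_mono) (auto simp: s_def)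
    then have "\<eta> * (s\<^sup>2 * K\<^sup>2) \<le> \<eta> * (S\<^sup>2 * K\<^sup>2)" using pos by (intro mult_left_mono mult_right_mono) auto
    then have "\<eta> * \<kappa>\<^sup>2 + \<eta> * (s\<^sup>2 * K\<^sup>2) \<le> \<kappa>"
      using eta_S unfolding distrib_left by linarith
    then have "\<eta> * (\<eta> * \<kappa>\<^sup>2 + \<eta> * (s\<^sup>2 * K\<^sup>2)) \<le> \<eta> * \<kappa>"
      using pos by (intro mult_left_mono) auto
    moreover have "0 \<le> \<eta> * (\<eta> * \<kappa>\<^sup>2)" using pos by simp
    ultimately show "r\<^sup>2 + (s * \<eta>)\<^sup>2 * K\<^sup>2 \<le> (1 - \<eta> * \<kappa> / 2)\<^sup>2"
      by (simp add: r_def power2_eq_square algebra_simps)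
    show "0 \<le> 1 - \<eta> * \<kappa> / 2" using eta_kappa mu_nonneg by simp
  qed (use psd MK c' pos in \<open>auto simp: w_def s_def\<close>)
  moreover have "s * \<eta> * a * euclid_norm q \<le> S * \<eta> * S * (K * euclid_norm y)"
    unfolding q_def using pos c by (intro mult_mono MK) (auto simp: s_def)
  moreover have "s * \<eta> * euclid_norm e \<le> S * \<eta> * euclid_norm e"
    using pos by (intro mult_right_mono) (auto simp: s_def)
  moreover have "(s * \<gamma> + r * \<alpha>) * euclid_norm \<nu> \<le> (S * \<gamma> + 1 * \<alpha>) * euclid_norm \<nu>"
    using pos by (intro mult_right_mono add_mono) (auto simp: s_def)
  moreover have "s \<ge> 0" using pos by (simp add: s_def)
  then have "euclid_norm (x' + a \<cdot>\<^sub>v y') \<le> euclid_norm (r \<cdot>\<^sub>v z - (s * \<eta>) \<cdot>\<^sub>v w)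
      + s * \<eta> * a * euclid_norm q + s * \<eta> * euclid_norm e + (s * \<gamma> + r * \<alpha>) * euclid_norm \<nu>"
    unfolding ident using pos c c'
      euclid_norm_combination4[of "r \<cdot>\<^sub>v z - (s * \<eta>) \<cdot>\<^sub>v w" N q e \<nu> 1 "s * \<eta> * a" "- (s * \<eta>)" "s * \<gamma> + r * \<alpha>"]
    by simp
  ultimately show "euclid_norm (x' + a \<cdot>\<^sub>v y') \<le> (1 - \<eta> * \<kappa> / 2) * euclid_norm (x + a \<cdot>\<^sub>v y)
      + \<eta> * S\<^sup>2 * K * euclid_norm y + S * \<eta> * euclid_norm e + (S * \<gamma> + \<alpha>) * euclid_norm \<nu>"
    by (simp add: z_def[symmetric] power2_eq_square ac_simps)
qed

text \<open>The scalars stand for the norms of \<open>x + a y\<close>, \<open>y\<close>,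
  \<open>x\<close>, the divergence error and the change of natural gradient. Of the rate
  \<open>\<eta> * \<kappa> / 2\<close>, the coupling of \<open>y\<close> to \<open>x\<close> uses
  1/4, and the error and the change of natural gradient use 1/16 each, which leaves 1/8.\<close>

lemma lyapunov_step:
  assumes nonneg: "0 \<le> Z" "0 \<le> Y" "0 \<le> X" "0 \<le> e" "0 \<le> \<nu>"
    and Z': "Z' \<le> (1 - \<eta> * \<kappa> / 2) * Z + \<eta> * S\<^sup>2 * K * Y + S * \<eta> * e + (S * \<gamma> + \<alpha>) * \<nu>"
    and Y': "Y' \<le> \<mu> * Y + \<eta> * K * X + \<eta> * e + \<gamma> * \<nu>"
    and X: "X \<le> Z + S * Y"
    and e: "e \<le> K * (X + \<alpha> * K)\<^sup>2"
    and nu: "\<nu> \<le> K * (\<mu> * Y + \<gamma> * K + \<eta> * K * X + \<eta> * e)"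
    and E: "Z + b * Y \<le> \<epsilon>"
  shows "Z' + b * Y' \<le> (1 - \<eta> * \<kappa> / 8) * (Z + b * Y) + C1 * \<eta> * \<alpha>\<^sup>2"
    and "X \<le> G * (Z + b * Y)"
proof -
  note pos = const_pos kappa_pos alpha_pos eta_pos gamma_bounds(1)
  define E where "E = Z + b * Y"
  have E0: "E \<ge> 0" using nonneg pos by (simp add: E_def)
  have "G * E = Z + S * Y + (S / b) * Z + b * Y"
    using pos by (simp add: E_def G_def field_simps)
  moreover have "(S / b) * Z + b * Y \<ge> 0" using nonneg pos by simp
  ultimately have XG: "X \<le> G * E" using X by linarith
  then show "X \<le> G * (Z + b * Y)" by (simp add: E_def)
  have "(X + \<alpha> * K)\<^sup>2 \<le> 2 * X\<^sup>2 + 2 * (\<alpha> * K)\<^sup>2"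
    using sum_squares_bound[of X "\<alpha> * K"] by (simp add: power2_sum)
  \<comment> \<open>One of the two factors \<open>E\<close> is traded for \<open>\<epsilon>\<close>,
    so the quadratic error becomes linear with a small coefficient.\<close>
  moreover have "X\<^sup>2 \<le> G\<^sup>2 * \<epsilon> * E"
  proof -
    have "X\<^sup>2 \<le> (G * E)\<^sup>2" using XG nonneg by (intro power_mono) auto
    also have "\<dots> = G\<^sup>2 * E * E" by (simp add: power2_eq_square)
    also have "\<dots> \<le> G\<^sup>2 * \<epsilon> * E"
      using E E0 by (intro mult_right_mono mult_left_mono) (auto simp: E_def)
    finally show ?thesis .
  qed
  ultimately have "(X + \<alpha> * K)\<^sup>2 \<le> 2 * (G\<^sup>2 * \<epsilon> * E) + 2 * (\<alpha> * K)\<^sup>2" by linarith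
  then have "e \<le> K * (2 * (G\<^sup>2 * \<epsilon> * E) + 2 * (\<alpha> * K)\<^sup>2)"
    using e K_ge_1 by (meson mult_left_mono order_trans zero_le_one)
  \<comment> \<open>The error acts with weight \<open>J\<close> directly and with weight
    \<open>J * K\<close> through the change of natural gradient; the denominator of
    \<open>\<epsilon>\<close> is fitted to this total.\<close>
  then have "J * (1 + K) * e \<le> J * (1 + K) * (K * (2 * (G\<^sup>2 * \<epsilon> * E) + 2 * (\<alpha> * K)\<^sup>2))"
    using pos K_ge_1 by (intro mult_left_mono) auto
  also have "\<dots> = (2 * K * G\<^sup>2 * (J * (1 + K)) * \<epsilon>) * E + 2 * (J * (1 + K)) * K ^ 3 * \<alpha>\<^sup>2"
    by (simp add: power2_eq_square power3_eq_cube algebra_simps)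
  also have "2 * K * G\<^sup>2 * (J * (1 + K)) * \<epsilon> = \<kappa> / 16"
  proof -
    define W where "W = K * G\<^sup>2 * (J * (1 + K))"
    have "W \<noteq> 0" using pos K_ge_1 by (auto simp: W_def)
    moreover have "\<epsilon> = \<kappa> / (32 * W)" by (simp add: \<epsilon>_def W_def mult.assoc)
    moreover have "2 * K * G\<^sup>2 * (J * (1 + K)) * \<epsilon> = 2 * W * \<epsilon>" by (simp add: W_def mult.assoc)
    ultimately show ?thesis by simp
  qed
  finally have Je: "J * (1 + K) * e \<le> \<kappa> / 16 * E + 2 * (J * (1 + K)) * K ^ 3 * \<alpha>\<^sup>2" .

  have "((S + b) * \<gamma> + \<alpha>) * \<nu> \<le> \<alpha> * J * \<nu>"
  proof (rule mult_right_mono)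
    have "(S + b) * \<gamma> \<le> (S + b) * \<alpha>" using pos gamma_bounds by (intro mult_left_mono) auto
    then show "(S + b) * \<gamma> + \<alpha> \<le> \<alpha> * J" by (simp add: J_def algebra_simps)
  qed (use nonneg in simp)
  also have "\<dots> \<le> \<alpha> * J * (K * (\<mu> * Y + \<gamma> * K + \<eta> * K * X + \<eta> * e))"
    using pos by (intro mult_left_mono nu) auto
  also have "\<dots> \<le> \<alpha> * J * (K * (Y + (2 * \<kappa> * \<eta> * \<alpha>) * K + \<eta> * K * (G * E))) + J * K * (\<eta> * e)"
  proof -
    have "\<mu> * Y \<le> 1 * Y" using nonneg mu_less_1 by (intro mult_right_mono) auto
    then have "\<mu> * Y + \<gamma> * K + \<eta> * K * X \<le> Y + (2 * \<kappa> * \<eta> * \<alpha>) * K + \<eta> * K * (G * E)"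
      using XG gamma_bounds K_ge_1 pos
      by (intro add_mono mult_right_mono mult_left_mono) auto
    then have "\<alpha> * J * (K * (\<mu> * Y + \<gamma> * K + \<eta> * K * X))
        \<le> \<alpha> * J * (K * (Y + (2 * \<kappa> * \<eta> * \<alpha>) * K + \<eta> * K * (G * E)))"
      using pos K_ge_1 by (intro mult_left_mono) auto
    moreover have "\<alpha> * (J * K * (\<eta> * e)) \<le> 1 * (J * K * (\<eta> * e))"
      using pos K_ge_1 nonneg alpha_le_1 by (intro mult_right_mono) auto
    ultimately show ?thesis by (simp add: algebra_simps)
  qed
  also have "\<dots> = \<alpha> * (J * K) * Y + 2 * \<kappa> * (J * K\<^sup>2) * \<eta> * \<alpha>\<^sup>2
      + \<eta> * (\<alpha> * (J * K\<^sup>2 * G)) * E + J * K * (\<eta> * e)"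
    by (simp add: power2_eq_square algebra_simps)
  also have "\<dots> \<le> b * (1 - \<mu>) / 2 * Y + 2 * \<kappa> * (J * K\<^sup>2) * \<eta> * \<alpha>\<^sup>2 + \<eta> * (\<kappa> / 16) * E + J * K * (\<eta> * e)"
    using alpha_J alpha_JG nonneg E0 pos
    by (intro add_mono mult_right_mono mult_left_mono order_refl) auto
  finally have nu': "((S + b) * \<gamma> + \<alpha>) * \<nu> \<le> \<dots>" .

  have "Z' + b * Y' \<le> (1 - \<eta> * \<kappa> / 2) * Z + \<eta> * S\<^sup>2 * K * Y + S * \<eta> * e + (S * \<gamma> + \<alpha>) * \<nu>
      + b * (\<mu> * Y + \<eta> * K * (Z + S * Y) + \<eta> * e + \<gamma> * \<nu>)"
  proof -
    have "\<eta> * K * X \<le> \<eta> * K * (Z + S * Y)" using X pos K_ge_1 by (intro mult_left_mono) auto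
    then have "Y' \<le> \<mu> * Y + \<eta> * K * (Z + S * Y) + \<eta> * e + \<gamma> * \<nu>"
      using Y' by linarith
    then have "b * Y' \<le> b * (\<mu> * Y + \<eta> * K * (Z + S * Y) + \<eta> * e + \<gamma> * \<nu>)"
      using pos by (intro mult_left_mono) auto
    with Z' show ?thesis by linarith
  qed
  also have "\<dots> = (1 - \<eta> * \<kappa> / 2) * Z + \<eta> * (b * K) * Z + (\<eta> * (S\<^sup>2 * K + b * K * S) + b * \<mu>) * Y
      + (S + b) * (\<eta> * e) + ((S + b) * \<gamma> + \<alpha>) * \<nu>"
    by (simp add: algebra_simps)
  also have "\<eta> * (b * K) * Z = \<eta> * \<kappa> / 4 * Z"
    using K_ge_1 by (simp add: b_def)
  also have "(1 - \<eta> * \<kappa> / 2) * Z + \<eta> * \<kappa> / 4 * Z + (\<eta> * (S\<^sup>2 * K + b * K * S) + b * \<mu>) * Y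
      + (S + b) * (\<eta> * e) + ((S + b) * \<gamma> + \<alpha>) * \<nu>
    \<le> (1 - \<eta> * \<kappa> / 4) * Z + (b * (1 - \<mu>) / 2 - \<eta> * (b * \<kappa> / 4) + b * \<mu>) * Y
      + J * (\<eta> * e) + (b * (1 - \<mu>) / 2 * Y + 2 * \<kappa> * (J * K\<^sup>2) * \<eta> * \<alpha>\<^sup>2 + \<eta> * (\<kappa> / 16) * E + J * K * (\<eta> * e))"
  proof -
    \<comment> \<open>\<open>eta_b\<close> pays for the terms of order \<eta> in \<open>Y\<close>
      with half of the momentum gap \<open>b * (1 - \<mu>)\<close>; the other half was spent on the
      change of natural gradient.\<close>
    have "(\<eta> * (S\<^sup>2 * K + b * K * S) + b * \<mu>) * Y \<le> (b * (1 - \<mu>) / 2 - \<eta> * (b * \<kappa> / 4) + b * \<mu>) * Y"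
      using eta_b nonneg by (intro mult_right_mono) (auto simp: algebra_simps)
    moreover have "(S + b) * (\<eta> * e) \<le> J * (\<eta> * e)"
      using pos nonneg by (intro mult_right_mono) auto
    moreover have "(1 - \<eta> * \<kappa> / 2) * Z + \<eta> * \<kappa> / 4 * Z = (1 - \<eta> * \<kappa> / 4) * Z"
      by (simp add: algebra_simps)
    ultimately show ?thesis using nu' by linarith
  qed
  \<comment> \<open>The two halves of the gap and \<open>b * \<mu>\<close> add up to
    \<open>b\<close>, so \<open>Y\<close> carries the same rate
    \<open>1 - \<eta> * \<kappa> / 4\<close> as \<open>Z\<close> and both combine into
    \<open>E\<close>.\<close>
  also have "\<dots> = (1 - \<eta> * \<kappa> / 4) * E + \<eta> * (\<kappa> / 16) * E + \<eta> * (J * (1 + K) * e) + 2 * \<kappa> * (J * K\<^sup>2) * \<eta> * \<alpha>\<^sup>2"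
    by (simp add: E_def field_simps)
  also have "\<dots> \<le> (1 - \<eta> * \<kappa> / 4) * E + \<eta> * (\<kappa> / 16) * E
      + \<eta> * (\<kappa> / 16 * E + 2 * (J * (1 + K)) * K ^ 3 * \<alpha>\<^sup>2) + 2 * \<kappa> * (J * K\<^sup>2) * \<eta> * \<alpha>\<^sup>2"
    using mult_left_mono[OF Je, of \<eta>] pos by linarith
  also have "\<dots> = (1 - \<eta> * \<kappa> / 8) * E + C1 * \<eta> * \<alpha>\<^sup>2"
    by (simp add: C1_def field_simps)
  finally show "Z' + b * Y' \<le> (1 - \<eta> * \<kappa> / 8) * (Z + b * Y) + C1 * \<eta> * \<alpha>\<^sup>2" by (simp add: E_def)
qed

text \<open>The weight \<open>16 c\<close> makes the decay of \<open>E\<close> pay for the term \<open>(\<gamma>/\<alpha>) X'\<close>.\<close>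

lemma averaging_step:
  assumes nonneg: "0 \<le> d" "0 \<le> X'"
    and d': "d' \<le> d + \<gamma> * (K * (d + 2 * (X' + \<alpha> * K))) + \<gamma> / \<alpha> * X'"
    and X': "X' \<le> G * E'" and E': "E' \<le> (1 - \<eta> * \<kappa> / 8) * E + C1 * \<eta> * \<alpha>\<^sup>2"
    and E: "0 \<le> E"
  shows "d' + 16 * c * E' \<le> (1 + \<gamma> * K) * (d + 16 * c * E) + C2 * \<gamma> * \<alpha>"
proof -
  note pos = const_pos kappa_pos alpha_pos eta_pos gamma_bounds(1)
  have "d' \<le> (1 + \<gamma> * K) * d + 2 * K\<^sup>2 * \<gamma> * \<alpha> + \<gamma> / \<alpha> * ((2 * K * \<alpha> + 1) * X')"
    using d' pos by (simp add: field_simps power2_eq_square)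
  also have "\<gamma> / \<alpha> * ((2 * K * \<alpha> + 1) * X') \<le> 2 * \<kappa> * \<eta> * (c * E')"
  proof (rule mult_mono)
    have "2 * K * \<alpha> \<le> 2 * K * 1" using alpha_le_1 K_ge_1 by (intro mult_left_mono) auto
    then have "(2 * K * \<alpha> + 1) * X' \<le> (2 * K + 1) * X'" using nonneg by (intro mult_right_mono) auto
    also have "\<dots> \<le> (2 * K + 1) * (G * E')" using X' K_ge_1 by (intro mult_left_mono) auto
    finally show "(2 * K * \<alpha> + 1) * X' \<le> c * E'" by (simp add: c_def)
    show "\<gamma> / \<alpha> \<le> 2 * \<kappa> * \<eta>" using gamma_bounds(2) pos by (simp add: field_simps)
  qed (use pos nonneg K_ge_1 in auto)
  finally have "d' + 16 * c * E' \<le> (1 + \<gamma> * K) * d + 2 * K\<^sup>2 * \<gamma> * \<alpha> + (16 + 2 * \<kappa> * \<eta>) * c * E'"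
    by (simp add: algebra_simps)
  also have "(16 + 2 * \<kappa> * \<eta>) * c * E' \<le> (16 + 2 * \<kappa> * \<eta>) * c * ((1 - \<eta> * \<kappa> / 8) * E + C1 * \<eta> * \<alpha>\<^sup>2)"
    using E' pos by (intro mult_left_mono) auto
  \<comment> \<open>The weight 16 makes the first-order terms cancel: (16 + 2h)(1 - h/8) = 16 -
    h^2/4 with h = \<open>\<eta> * \<kappa>\<close>.\<close>
  also have "\<dots> = 16 * c * E - (\<eta> * \<kappa>)\<^sup>2 / 4 * (c * E) + (16 + 2 * (\<eta> * \<kappa>)) * c * C1 * (\<eta> * \<alpha>\<^sup>2)"
    by (simp add: field_simps power2_eq_square)
  also have "\<dots> \<le> 16 * c * E + 32 * c * C1 * (\<gamma> * \<alpha> / \<kappa>)"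
  proof -
    have "(16 + 2 * (\<eta> * \<kappa>)) * (c * C1 * (\<eta> * \<alpha>\<^sup>2)) \<le> 32 * (c * C1 * (\<gamma> * \<alpha> / \<kappa>))"
      using pos gamma_bounds eta_kappa mu_nonneg by (intro mult_mono mult_left_mono) auto
    moreover have "(\<eta> * \<kappa>)\<^sup>2 / 4 * (c * E) \<ge> 0" using pos E by simp
    ultimately show ?thesis by (simp add: mult.assoc)
  qed
  finally have "d' + 16 * c * E' \<le> (1 + \<gamma> * K) * d + 16 * c * E + C2 * \<gamma> * \<alpha>"
    by (simp add: C2_def algebra_simps)
  \<comment> \<open>Granting \<open>E\<close> the growth factor \<open>1 + \<gamma> * K\<close> as
    well puts the estimate in the form required by \<open>discrete_gronwall\<close>.\<close>
  moreover have "\<gamma> * K * (16 * c * E) \<ge> 0" using pos K_ge_1 E by simp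
  ultimately show ?thesis by (simp add: algebra_simps)
qed

end

text \<open>Each entry of the two minima solves one inequality of \<open>small_rates\<close>. The
  entry \<open>exp (- 1)\<close> also makes \<open>ln (1 / \<alpha>)\<close> at least 1.\<close>

lemma (in drift_constants) small_rates_exist:
  obtains \<alpha>0 \<eta>0 where "0 < \<alpha>0" "\<alpha>0 \<le> exp (- 1)" "0 < \<eta>0" "\<eta>0 < 1 / \<kappa>"
    "\<And>\<alpha> \<eta>. 0 < \<alpha> \<Longrightarrow> \<alpha> \<le> \<alpha>0 \<Longrightarrow> 0 < \<eta> \<Longrightarrow> \<eta> \<le> \<eta>0 \<Longrightarrow> small_rates \<kappa> \<mu> K \<alpha> \<eta>"
proof -
  note pos = const_pos kappa_pos mu_less_1
  define Q where "Q = S\<^sup>2 * K + b * K * S + b * \<kappa> / 4"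
  define \<alpha>0 where "\<alpha>0 = Min {exp (- 1), b * (1 - \<mu>) / 2 / (J * K), \<kappa> / 16 / (J * K\<^sup>2 * G), \<epsilon> / B}"
  define \<eta>0 where "\<eta>0 = Min {(1 - \<mu>) / 2 / \<kappa>, \<kappa> / (\<kappa>\<^sup>2 + S\<^sup>2 * K\<^sup>2),
    b * (1 - \<mu>) / 2 / Q}"
  have JK: "J * K > 0" "J * K\<^sup>2 * G > 0" using pos K_ge_1 by auto
  have den: "\<kappa>\<^sup>2 + S\<^sup>2 * K\<^sup>2 > 0" "Q > 0"
    using pos K_ge_1 unfolding Q_def by (auto intro!: add_pos_pos)
  show thesis
  proof
    show "0 < \<alpha>0" "\<alpha>0 \<le> exp (- 1)" using pos JK by (auto simp: \<alpha>0_def)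
    show "0 < \<eta>0" using pos den by (auto simp: \<eta>0_def)
    have "(1 - \<mu>) / 2 / \<kappa> < 1 / \<kappa>" using pos mu_nonneg by (intro divide_strict_right_mono) auto
    then show "\<eta>0 < 1 / \<kappa>" by (simp add: \<eta>0_def)
    fix \<alpha> \<eta> :: real assume *: "0 < \<alpha>" "\<alpha> \<le> \<alpha>0" "0 < \<eta>" "\<eta> \<le> \<eta>0"
    have "exp (- 1) \<le> (1 :: real)" by simp
    moreover have "\<alpha> \<le> exp (- 1)" using * by (simp add: \<alpha>0_def)
    ultimately have le_1: "\<alpha> \<le> 1" by linarith
    have "\<eta> \<le> b * (1 - \<mu>) / 2 / Q" using * by (simp add: \<eta>0_def)
    then have "\<eta> * Q \<le> b * (1 - \<mu>) / 2" using den(2) by (subst (asm) pos_le_divide_eq)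
    note this[unfolded Q_def]
    with le_1 show "small_rates \<kappa> \<mu> K \<alpha> \<eta>"
      using * pos JK den
      by unfold_locales (simp_all add: \<alpha>0_def \<eta>0_def pos_le_divide_eq mult.commute)
  qed
qed

section \<open>The mean teacher iterates\<close>

locale mean_teacher_run = small_rates +
  fixes lam :: real and N :: nat and L :: "real vec \<Rightarrow> real"
    and D :: "real vec \<Rightarrow> real vec \<Rightarrow> real" and H :: "real vec \<Rightarrow> real mat" and \<theta>0 :: "real vec"
  assumes lam_nonneg: "lam \<ge> 0"
    and L_diff: "differentiable_vec N L"
    and D_diff: "\<And>p. p \<in> carrier_vec N \<Longrightarrow> differentiable_vec N (\<lambda>\<theta>. D \<theta> p)"
    and H_spd: "\<And>\<theta>. \<theta> \<in> carrier_vec N \<Longrightarrow> sym_pos_def N (H \<theta>)"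
    and regular: "regularity_condition N K {lam, lam + (1 - \<mu>) * \<kappa> / (1 - \<eta> * \<kappa>)} L D H"
    and start: "\<theta>0 \<in> carrier_vec N"
begin

definition "lam_bar = lam + (1 - \<mu>) * \<kappa> / (1 - \<eta> * \<kappa>)"
definition "state t = mean_teacher_state N L D \<eta> lam \<mu> \<alpha> \<kappa> \<theta>0 t"
definition "student t = fst (state t)"
definition "previous t = fst (snd (state t))"
definition "teacher t = snd (snd (state t))"
definition "ngrad = natural_grad N lam_bar L H"
definition "x t = (student t - teacher t) + \<alpha> \<cdot>\<^sub>v ngrad (student t)"
definition "y t = (student t - previous t) + \<gamma> \<cdot>\<^sub>v ngrad (student t)"
definition "E t = euclid_norm (x t + a \<cdot>\<^sub>v y t) + b * euclid_norm (y t)"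
text \<open>Linearising with \<open>H\<close> at the student, not at the teacher, gives the same
  matrix that is damped and inverted in \<open>ngrad (student t)\<close>.\<close>

definition "err t = gradient N (\<lambda>u. D u (teacher t)) (student t) - H (student t) *\<^sub>v (student t - teacher t)"
definition "descent t = natural_descent N L H \<gamma> lam_bar \<theta>0 t"

lemma lam_bar_nonneg: "lam_bar \<ge> 0"
  using lam_nonneg mu_less_1 kappa_pos r_bounds by (simp add: lam_bar_def r_def)

lemma gradient_L_carrier: "u \<in> carrier_vec N \<Longrightarrow> gradient N L u \<in> carrier_vec N"
  using has_gradient_gradient[OF L_diff] by (simp add: has_gradient_def)

lemma gradient_D_carrier:
  "u \<in> carrier_vec N \<Longrightarrow> p \<in> carrier_vec N \<Longrightarrow> gradient N (\<lambda>u. D u p) u \<in> carrier_vec N"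
  using has_gradient_gradient[OF D_diff] by (simp add: has_gradient_def)

lemma H_carrier: "u \<in> carrier_vec N \<Longrightarrow> H u \<in> carrier_mat N N"
  using H_spd by (simp add: sym_pos_def_def)

lemma ngrad_carrier: "u \<in> carrier_vec N \<Longrightarrow> ngrad u \<in> carrier_vec N"
  unfolding ngrad_def by (intro natural_grad_carrier H_spd lam_bar_nonneg gradient_L_carrier)

lemma regular_bounds:
  assumes "u \<in> carrier_vec N" "p \<in> carrier_vec N"
  shows "op_norm (damped_mat N lam H u) \<le> K"
    and "euclid_norm (ngrad u - ngrad p) \<le> K * euclid_norm (u - p)"
    and "euclid_norm (gradient N (\<lambda>x. D x p) u - H u *\<^sub>v (u - p)) \<le> K * (euclid_norm (u - p))\<^sup>2"
    and "euclid_norm (ngrad u) \<le> K"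
  using regular assms unfolding regularity_condition_def ngrad_def lam_bar_def by blast+

lemma state_0:
  "student 0 = \<theta>0" "previous 0 = \<theta>0" "teacher 0 = \<theta>0"
  by (simp_all add: student_def previous_def teacher_def state_def)

lemma state_Suc:
  "previous (Suc t) = student t"
  "student (Suc t) = student t - \<eta> \<cdot>\<^sub>v gradient N (\<lambda>u. \<alpha> * L u + damped_div lam D u (teacher t)) (student t)
    + \<mu> \<cdot>\<^sub>v (student t - previous t)"
  "teacher (Suc t) = (1 - \<eta> * \<kappa>) \<cdot>\<^sub>v teacher t + (\<eta> * \<kappa>) \<cdot>\<^sub>v student (Suc t)"
  by (simp_all add: student_def previous_def teacher_def state_def Let_def split: prod.split)

lemma gradient_objective:
  assumes "u \<in> carrier_vec N" "p \<in> carrier_vec N"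
  shows "gradient N (\<lambda>u. \<alpha> * L u + damped_div lam D u p) u =
    \<alpha> \<cdot>\<^sub>v gradient N L u + (gradient N (\<lambda>u. D u p) u + lam \<cdot>\<^sub>v (u - p))"
  using assms by (intro gradient_damped_objective L_diff D_diff)

lemma state_carrier:
  "student t \<in> carrier_vec N \<and> previous t \<in> carrier_vec N \<and> teacher t \<in> carrier_vec N"
proof (induction t)
  case 0
  then show ?case using start by (simp add: state_0)
next
  case (Suc t)
  then show ?case
    by (auto simp: state_Suc gradient_objective
        intro!: add_carrier_vec minus_carrier_vec smult_carrier_vec gradient_L_carrier gradient_D_carrier)
qed

lemmas carriers = state_carrier[THEN conjunct1] state_carrier[THEN conjunct2, THEN conjunct1]
  state_carrier[THEN conjunct2, THEN conjunct2]

section \<open>Recursion for the deviations from the stationary regime\<close>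

lemma ngrad_student_carrier: "ngrad (student t) \<in> carrier_vec N"
  by (intro ngrad_carrier carriers)

lemma err_carrier: "err t \<in> carrier_vec N"
  unfolding err_def using carriers[of t] H_carrier[of "student t"]
  by (auto intro!: minus_carrier_vec gradient_D_carrier mult_mat_vec_carrier)

lemma xy_carrier: "x t \<in> carrier_vec N" "y t \<in> carrier_vec N"
  using carriers[of t] ngrad_student_carrier[of t] by (auto simp: x_def y_def)

text \<open>With the gradient of \<open>L\<close> written through the natural gradient, the matrix
  terms combine into the damped matrix applied to \<open>x t\<close>, and the scalar multiples of
  the natural gradient collapse to the drift of natural gradient descent.\<close>

lemma velocity_Suc:
  "student (Suc t) - student t = \<mu> \<cdot>\<^sub>v y t - \<gamma> \<cdot>\<^sub>v ngrad (student t)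
    - \<eta> \<cdot>\<^sub>v (damped_mat N lam H (student t) *\<^sub>v x t) - \<eta> \<cdot>\<^sub>v err t"
proof -
  define u where "u = student t"
  define p where "p = previous t"
  define w where "w = teacher t"
  define n where "n = ngrad u"
  define g where "g = gradient N (\<lambda>u. D u w) u"
  define Hd where "Hd = H u *\<^sub>v (u - w)"
  define Hn where "Hn = H u *\<^sub>v n"
  have c: "u \<in> carrier_vec N" "p \<in> carrier_vec N" "w \<in> carrier_vec N" "n \<in> carrier_vec N"
    and HN: "H u \<in> carrier_mat N N"
    using carriers[of t] ngrad_student_carrier[of t] H_carrier by (auto simp: u_def p_def w_def n_def)
  have c': "g \<in> carrier_vec N" "Hd \<in> carrier_vec N" "Hn \<in> carrier_vec N"
    using c HN by (auto simp: g_def Hd_def Hn_def intro!: gradient_D_carrier mult_mat_vec_carrier)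
  have GL: "gradient N L u = Hn + lam_bar \<cdot>\<^sub>v n"
    using damped_mat_natural_grad[of N H u lam_bar L] H_spd[of u] lam_bar_nonneg gradient_L_carrier[of u] c HN
    by (simp add: n_def ngrad_def Hn_def damped_mat_mult_vec)
  have Mx: "damped_mat N lam H u *\<^sub>v x t = Hd + \<alpha> \<cdot>\<^sub>v Hn + lam \<cdot>\<^sub>v (u - w) + (lam * \<alpha>) \<cdot>\<^sub>v n"
  proof -
    have "H u *\<^sub>v x t = Hd + \<alpha> \<cdot>\<^sub>v Hn"
      using c HN unfolding x_def Hd_def Hn_def
      by (simp add: mult_add_distrib_mat_vec[of _ N N] mult_mat_vec[of _ N N] flip: u_def w_def n_def)
    moreover have "lam \<cdot>\<^sub>v x t = lam \<cdot>\<^sub>v (u - w) + (lam * \<alpha>) \<cdot>\<^sub>v n"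
      using c unfolding x_def u_def[symmetric] w_def[symmetric] n_def[symmetric]
      by (intro eq_vecI) (auto simp: algebra_simps)
    ultimately show ?thesis
      using xy_carrier[of t] HN c c' by (simp add: damped_mat_mult_vec assoc_add_vec[of _ N])
  qed
  \<comment> \<open>This is the reason for the value of \<open>lam_bar\<close>: its excess over
    \<open>lam\<close>, times \<open>\<eta> * \<alpha>\<close>, is
    \<open>(1 - \<mu>) * \<gamma>\<close>, the drift corrected for momentum.\<close>
  have gap: "\<eta> * (\<alpha> * lam_bar) = \<eta> * (\<alpha> * lam) + \<gamma> - \<mu> * \<gamma>"
    unfolding lam_bar_def \<gamma>_def by (simp add: field_simps diff_divide_distrib)
  show ?thesis
  proof (rule eq_vecI)
    fix i assume "i < dim_vec (\<mu> \<cdot>\<^sub>v y t - \<gamma> \<cdot>\<^sub>v ngrad (student t)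
      - \<eta> \<cdot>\<^sub>v (damped_mat N lam H (student t) *\<^sub>v x t) - \<eta> \<cdot>\<^sub>v err t)"
    then have i: "i < N" using err_carrier[of t] by simp
    have "\<eta> * (\<alpha> * lam_bar) * n $ i = \<eta> * (\<alpha> * lam) * n $ i + \<gamma> * n $ i - \<mu> * \<gamma> * n $ i"
      unfolding gap by (simp add: algebra_simps)
    then show "(student (Suc t) - student t) $ i = (\<mu> \<cdot>\<^sub>v y t - \<gamma> \<cdot>\<^sub>v ngrad (student t)
      - \<eta> \<cdot>\<^sub>v (damped_mat N lam H (student t) *\<^sub>v x t) - \<eta> \<cdot>\<^sub>v err t) $ i"
      unfolding state_Suc err_def y_def u_def[symmetric] p_def[symmetric] w_def[symmetric] n_def[symmetric] Mx
        gradient_objective[OF c(1,3)] GL g_def[symmetric] Hd_def[symmetric]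
      using c c' i by (simp add: algebra_simps)
  qed (use carriers(1)[of t] carriers(1)[of "Suc t"] err_carrier[of t] in simp)
qed

text \<open>The drift cancels in \<open>y\<close>, and only the change of the natural gradient
  remains, which the Lipschitz condition controls.\<close>

lemma y_Suc:
  "y (Suc t) = \<mu> \<cdot>\<^sub>v y t - \<eta> \<cdot>\<^sub>v (damped_mat N lam H (student t) *\<^sub>v x t) - \<eta> \<cdot>\<^sub>v err t
    + \<gamma> \<cdot>\<^sub>v (ngrad (student (Suc t)) - ngrad (student t))"
proof -
  define M where "M = damped_mat N lam H (student t) *\<^sub>v x t"
  have "M \<in> carrier_vec N"
    
    unfolding M_def by (intro mult_mat_vec_carrier[of _ N N] damped_mat_carrier H_carrier carriers xy_carrier)
  then show ?thesis
    using err_carrier[of t] xy_carrier[of t] ngrad_student_carrier[of t] ngrad_student_carrier[of "Suc t"]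
    unfolding y_def[of "Suc t"] state_Suc(1) velocity_Suc M_def[symmetric]
    by (intro eq_vecI) (auto simp: algebra_simps)
qed

text \<open>Averaging multiplies the gap between the new student and the old teacher by
  \<open>r\<close>; the offset is consistent because
  \<open>r * (\<alpha> + \<gamma>) = \<alpha>\<close>.\<close>

lemma x_Suc:
  "x (Suc t) = r \<cdot>\<^sub>v (x t + y (Suc t) + \<alpha> \<cdot>\<^sub>v (ngrad (student (Suc t)) - ngrad (student t)))"
proof (rule eq_vecI)
  let ?R = "r \<cdot>\<^sub>v (x t + y (Suc t) + \<alpha> \<cdot>\<^sub>v (ngrad (student (Suc t)) - ngrad (student t)))"
  define u where "u = student (Suc t)"
  define n where "n = ngrad u"
  fix i assume "i < dim_vec ?R"
  then have i: "i < N" using ngrad_student_carrier[of t] by simp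
  have "r * \<gamma> = \<alpha> - r * \<alpha>" using gamma_eq by (simp add: r_def algebra_simps)
  then have "r * \<gamma> * n $ i = (\<alpha> - r * \<alpha>) * n $ i" by simp
  then show "x (Suc t) $ i = ?R $ i"
    unfolding x_def y_def state_Suc(1,3) u_def[symmetric] n_def[symmetric]
    using i carriers[of t] carriers[of "Suc t"] ngrad_student_carrier[of t] ngrad_student_carrier[of "Suc t"]
    by (simp add: r_def algebra_simps flip: u_def n_def)
qed (use ngrad_student_carrier[of t] xy_carrier(1)[of "Suc t"] in simp)

lemma distance_le: "euclid_norm (student t - teacher t) \<le> euclid_norm (x t) + \<alpha> * K"
proof -
  have "student t - teacher t = x t - \<alpha> \<cdot>\<^sub>v ngrad (student t)"
    using carriers[of t] ngrad_student_carrier[of t] by (intro eq_vecI) (auto simp: x_def)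
  also have "euclid_norm \<dots> \<le> euclid_norm (x t) + \<alpha> * euclid_norm (ngrad (student t))"
    using euclid_norm_triangle_minus[of "x t" N "\<alpha> \<cdot>\<^sub>v ngrad (student t)"] xy_carrier[of t]
      ngrad_student_carrier[of t] alpha_pos by (simp add: euclid_norm_smult)
  also have "\<alpha> * euclid_norm (ngrad (student t)) \<le> \<alpha> * K"
    using alpha_pos regular_bounds(4) carriers by (intro mult_left_mono) auto
  finally show ?thesis by simp
qed

lemma E_step:
  assumes "E t \<le> \<epsilon>"
  shows "E (Suc t) \<le> (1 - \<eta> * \<kappa> / 8) * E t + C1 * \<eta> * \<alpha>\<^sup>2" and "euclid_norm (x t) \<le> G * E t"
proof -
  define M where "M = damped_mat N lam H (student t)"
  define \<nu> where "\<nu> = ngrad (student (Suc t)) - ngrad (student t)"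
  define e where "e = err t"
  have M: "M \<in> carrier_mat N N" unfolding M_def by (intro damped_mat_carrier H_carrier carriers)
  have psd: "v \<bullet> (M *\<^sub>v v) \<ge> 0" if "v \<in> carrier_vec N" for v
    unfolding M_def using that by (intro damped_mat_psd H_spd lam_nonneg carriers)
  have MK: "euclid_norm (M *\<^sub>v v) \<le> K * euclid_norm v" if "v \<in> carrier_vec N" for v
    using M that regular_bounds(1)[OF carriers(1) carriers(1)] unfolding M_def
    by (intro euclid_norm_mult_mat_vec_le)
  have nu: "\<nu> \<in> carrier_vec N" using ngrad_student_carrier by (simp add: \<nu>_def)
  have e: "e \<in> carrier_vec N" using err_carrier by (simp add: e_def)
  note steps = heavy_ball_step[OF M psd MK xy_carrier[of t] e nu
      y_Suc[of t, folded M_def \<nu>_def e_def] x_Suc[of t, folded \<nu>_def]]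
  have X: "euclid_norm (x t) \<le> euclid_norm (x t + a \<cdot>\<^sub>v y t) + S * euclid_norm (y t)"
  proof -
    have "x t = (x t + a \<cdot>\<^sub>v y t) - a \<cdot>\<^sub>v y t" using xy_carrier[of t] by (intro eq_vecI) auto
    then have "euclid_norm (x t) \<le> euclid_norm (x t + a \<cdot>\<^sub>v y t) + a * euclid_norm (y t)"
      using euclid_norm_triangle_minus[of "x t + a \<cdot>\<^sub>v y t" N "a \<cdot>\<^sub>v y t"] xy_carrier[of t] a_bounds
      by (simp add: euclid_norm_smult)
    also have "a * euclid_norm (y t) \<le> S * euclid_norm (y t)"
      using a_bounds by (intro mult_right_mono) auto
    finally show ?thesis by simp
  qed
  have eK: "euclid_norm e \<le> K * (euclid_norm (x t) + \<alpha> * K)\<^sup>2"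
  proof -
    have "euclid_norm e \<le> K * (euclid_norm (student t - teacher t))\<^sup>2"
      unfolding e_def err_def by (intro regular_bounds carriers)
    also have "\<dots> \<le> K * (euclid_norm (x t) + \<alpha> * K)\<^sup>2"
      using K_ge_1 distance_le by (intro mult_left_mono power_mono) auto
    finally show ?thesis .
  qed
  \<comment> \<open>The change of natural gradient is at most \<open>K\<close> times the student's
    step, and \<open>velocity_Suc\<close> expresses that step through the deviations.\<close>
  have nuK: "euclid_norm \<nu> \<le> K * (\<mu> * euclid_norm (y t) + \<gamma> * K + \<eta> * K * euclid_norm (x t) + \<eta> * euclid_norm e)"
  proof -
    define n where "n = ngrad (student t)"
    have n: "n \<in> carrier_vec N" using ngrad_student_carrier by (simp add: n_def)
    have Mx: "M *\<^sub>v x t \<in> carrier_vec N" using M xy_carrier by (intro mult_mat_vec_carrier)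
    have "student (Suc t) - student t = \<mu> \<cdot>\<^sub>v y t + (- \<gamma>) \<cdot>\<^sub>v n + (- \<eta>) \<cdot>\<^sub>v (M *\<^sub>v x t) + (- \<eta>) \<cdot>\<^sub>v e"
      unfolding velocity_Suc M_def[symmetric] e_def[symmetric] n_def[symmetric]
      using Mx n e xy_carrier[of t] M by (intro eq_vecI) auto
    then have "euclid_norm (student (Suc t) - student t) \<le>
        \<mu> * euclid_norm (y t) + \<gamma> * euclid_norm n + \<eta> * euclid_norm (M *\<^sub>v x t) + \<eta> * euclid_norm e"
      using euclid_norm_combination4[of "y t" N n "M *\<^sub>v x t" e \<mu> "- \<gamma>" "- \<eta>" "- \<eta>"]
        Mx n e xy_carrier[of t] gamma_bounds eta_pos mu_nonneg by simp
    moreover have "\<gamma> * euclid_norm n \<le> \<gamma> * K"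
      using gamma_bounds regular_bounds(4) carriers by (intro mult_left_mono) (auto simp: n_def)
    moreover have "\<eta> * euclid_norm (M *\<^sub>v x t) \<le> \<eta> * (K * euclid_norm (x t))"
      using eta_pos MK xy_carrier by (intro mult_left_mono) auto
    ultimately have "euclid_norm (student (Suc t) - student t) \<le>
        \<mu> * euclid_norm (y t) + \<gamma> * K + \<eta> * K * euclid_norm (x t) + \<eta> * euclid_norm e"
      by simp
    then have "K * euclid_norm (student (Suc t) - student t) \<le>
        K * (\<mu> * euclid_norm (y t) + \<gamma> * K + \<eta> * K * euclid_norm (x t) + \<eta> * euclid_norm e)"
      using K_ge_1 by (intro mult_left_mono) auto
    then show ?thesis
      using regular_bounds(2)[OF carriers(1)[of "Suc t"] carriers(1)[of t]] unfolding \<nu>_def by linarith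
  qed
  note step = lyapunov_step[OF euclid_norm_nonneg euclid_norm_nonneg euclid_norm_nonneg euclid_norm_nonneg
      euclid_norm_nonneg steps X eK nuK assms[unfolded E_def]]
  show "E (Suc t) \<le> (1 - \<eta> * \<kappa> / 8) * E t + C1 * \<eta> * \<alpha>\<^sup>2"
    using step(1) by (simp add: E_def)
  show "euclid_norm (x t) \<le> G * E t"
    using step(2) by (simp add: E_def)
qed

section \<open>Uniform smallness of the deviations\<close>

lemma E_nonneg: "E t \<ge> 0"
  using const_pos by (simp add: E_def)

text \<open>Initially the gap and the velocity vanish, so both deviations are multiples of the same
  natural gradient, with coefficients \<alpha> and \<open>\<gamma> \<le> \<alpha>\<close>.\<close>

lemma E_0: "E 0 \<le> J * K * \<alpha>"
proof -
  define n where "n = ngrad \<theta>0"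
  have n: "n \<in> carrier_vec N" "euclid_norm n \<le> K"
    using ngrad_carrier start regular_bounds(4) by (auto simp: n_def)
  have x0: "x 0 = \<alpha> \<cdot>\<^sub>v n" and y0: "y 0 = \<gamma> \<cdot>\<^sub>v n"
    using start n by (auto simp: x_def y_def state_0 n_def)
  have "x 0 + a \<cdot>\<^sub>v y 0 = (\<alpha> + a * \<gamma>) \<cdot>\<^sub>v n"
    unfolding x0 y0 using n by (intro eq_vecI) (auto simp: algebra_simps)
  then have "E 0 = (\<alpha> + a * \<gamma> + b * \<gamma>) * euclid_norm n"
    using n gamma_bounds alpha_pos a_bounds by (simp add: E_def y0 euclid_norm_smult algebra_simps)
  also have "\<dots> \<le> (\<alpha> + S * \<alpha> + b * \<alpha>) * K"
    using n gamma_bounds alpha_pos a_bounds const_pos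
    by (intro mult_mono add_mono) auto
  also have "\<dots> = J * K * \<alpha>" by (simp add: J_def algebra_simps)
  finally show ?thesis .
qed

text \<open>\<open>E_step\<close> applies only below \<open>\<epsilon>\<close>, so an invariant is
  needed. In \<open>B\<close> the summand \<open>J * K\<close> covers the start, and
  \<open>8 * C1 / \<kappa>\<close> lets the contraction outweigh the forcing.\<close>

lemma E_le: "E t \<le> B * \<alpha>"
proof (induction t)
  case 0
  have "J * K * \<alpha> \<le> B * \<alpha>"
    using alpha_pos kappa_pos const_pos(6) unfolding B_def by (intro mult_right_mono) auto
  then show ?case using E_0 by linarith
next
  case (Suc t)
  have "E (Suc t) \<le> (1 - \<eta> * \<kappa> / 8) * E t + C1 * \<eta> * \<alpha>\<^sup>2"
    using E_step(1) Suc alpha_B by simp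
  also have "(1 - \<eta> * \<kappa> / 8) * E t \<le> (1 - \<eta> * \<kappa> / 8) * (B * \<alpha>)"
    using Suc eta_kappa mu_nonneg by (intro mult_left_mono) auto
  also have "C1 * \<eta> * \<alpha>\<^sup>2 \<le> \<eta> * \<kappa> / 8 * (B * \<alpha>)"
  proof -
    have "8 * C1 / \<kappa> \<le> B" using const_pos K_ge_1 by (simp add: B_def)
    then have "C1 \<le> \<kappa> / 8 * B" using kappa_pos by (simp add: field_simps)
    then have "C1 * \<alpha> \<le> \<kappa> / 8 * B * 1"
      using const_pos kappa_pos alpha_pos alpha_le_1 by (intro mult_mono) auto
    then have "\<eta> * \<alpha> * (C1 * \<alpha>) \<le> \<eta> * \<alpha> * (\<kappa> / 8 * B * 1)"
      using eta_pos alpha_pos by (intro mult_left_mono) auto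
    then show ?thesis by (simp add: power2_eq_square algebra_simps)
  qed
  finally show ?case by (simp add: algebra_simps)
qed

lemma E_small: "E t \<le> \<epsilon>"
  using E_le[of t] alpha_B by linarith

section \<open>Comparison of the teacher with natural gradient descent\<close>

lemma descent_carrier: "descent t \<in> carrier_vec N"
  by (induction t) (auto simp: descent_def start ngrad_carrier[unfolded ngrad_def])

text \<open>The teacher's move is a natural gradient step, evaluated at the new student, plus
  \<open>\<gamma> / \<alpha>\<close> times the deviation; the Lipschitz condition compares that step
  with the one of the descent.\<close>

lemma teacher_step:
  "euclid_norm (teacher (Suc t) - descent (Suc t)) \<le> euclid_norm (teacher t - descent t)
    + \<gamma> * (K * (euclid_norm (teacher t - descent t) + 2 * (euclid_norm (x (Suc t)) + \<alpha> * K)))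
    + \<gamma> / \<alpha> * euclid_norm (x (Suc t))"
proof -
  define u where "u = student (Suc t)"
  define n where "n = ngrad u"
  define m where "m = ngrad (descent t)"
  have c: "u \<in> carrier_vec N" "teacher t \<in> carrier_vec N" "descent t \<in> carrier_vec N"
      "n \<in> carrier_vec N" "m \<in> carrier_vec N" "x (Suc t) \<in> carrier_vec N"
    using carriers descent_carrier ngrad_carrier xy_carrier by (auto simp: u_def n_def m_def)
  have "\<gamma> / \<alpha> * r = \<eta> * \<kappa>"
    using gamma_eq alpha_pos by (simp add: field_simps)
  moreover have "x (Suc t) = r \<cdot>\<^sub>v (u - teacher t) + \<alpha> \<cdot>\<^sub>v n"
    unfolding x_def state_Suc(3) u_def[symmetric] n_def[symmetric] using c
    by (intro eq_vecI) (auto simp: r_def algebra_simps)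
  ultimately have gx: "(\<gamma> / \<alpha>) * x (Suc t) $ i = \<eta> * \<kappa> * (u $ i - teacher t $ i) + \<gamma> * n $ i"
    if "i < N" for i
    using that c alpha_pos by (simp add: distrib_left flip: mult.assoc)
  have "teacher (Suc t) - descent (Suc t)
      = 1 \<cdot>\<^sub>v (teacher t - descent t) + (- \<gamma>) \<cdot>\<^sub>v (n - m) + (\<gamma> / \<alpha>) \<cdot>\<^sub>v x (Suc t) + 0 \<cdot>\<^sub>v x (Suc t)"
    (is "_ = ?R")
  proof (rule eq_vecI)
    fix i assume "i < dim_vec ?R"
    then have i: "i < N" using c by simp
    have "?R $ i = teacher t $ i - descent t $ i - \<gamma> * (n $ i - m $ i) + (\<gamma> / \<alpha>) * x (Suc t) $ i"
      using c i by simp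
    moreover have "descent (Suc t) = descent t - \<gamma> \<cdot>\<^sub>v m"
      by (simp add: descent_def m_def ngrad_def)
    ultimately show "(teacher (Suc t) - descent (Suc t)) $ i = ?R $ i"
      unfolding gx[OF i] state_Suc(3) u_def[symmetric] using c i by (simp add: algebra_simps)
  qed (use c descent_carrier[of "Suc t"] in simp)
  then have "euclid_norm (teacher (Suc t) - descent (Suc t)) \<le> euclid_norm (teacher t - descent t)
      + \<gamma> * euclid_norm (n - m) + \<gamma> / \<alpha> * euclid_norm (x (Suc t))"
    using euclid_norm_combination4[of "teacher t - descent t" N "n - m" "x (Suc t)" "x (Suc t)" 1 "- \<gamma>" "\<gamma> / \<alpha>" 0]
      c gamma_bounds alpha_pos by simp
  moreover have "euclid_norm (n - m) \<le> K * (euclid_norm (teacher t - descent t) + 2 * (euclid_norm (x (Suc t)) + \<alpha> * K))"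
  proof -
    have "u - descent t = 1 \<cdot>\<^sub>v (teacher t - descent t) + (u - teacher t)"
      using c by (intro eq_vecI) auto
    then have 1: "euclid_norm (u - descent t) \<le> euclid_norm (teacher t - descent t) + euclid_norm (u - teacher t)"
      using c euclid_norm_triangle[of "teacher t - descent t" N "u - teacher t"] by simp
    \<comment> \<open>The known gap is to the new teacher. The gap to the old one is larger by
      \<open>1 / r\<close>, at most 2, whence the factor 2 in the statement.\<close>
    have "u - teacher (Suc t) = r \<cdot>\<^sub>v (u - teacher t)"
      unfolding state_Suc(3) u_def[symmetric] using c
      by (intro eq_vecI) (auto simp: r_def algebra_simps)
    then have "r * euclid_norm (u - teacher t) \<le> euclid_norm (x (Suc t)) + \<alpha> * K"
      using distance_le[of "Suc t"] c r_bounds euclid_norm_smult[of "u - teacher t" N r] by (simp flip: u_def)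
    moreover have "1 / 2 * euclid_norm (u - teacher t) \<le> r * euclid_norm (u - teacher t)"
      using r_bounds by (intro mult_right_mono) auto
    ultimately have "1 / 2 * euclid_norm (u - teacher t) \<le> euclid_norm (x (Suc t)) + \<alpha> * K"
      by (rule order_trans[rotated])
    then have "euclid_norm (u - descent t) \<le> euclid_norm (teacher t - descent t) + 2 * (euclid_norm (x (Suc t)) + \<alpha> * K)"
      using 1 by simp
    then have "K * euclid_norm (u - descent t) \<le> K * (euclid_norm (teacher t - descent t) + 2 * (euclid_norm (x (Suc t)) + \<alpha> * K))"
      using K_ge_1 by (intro mult_left_mono) auto
    then show ?thesis
      using regular_bounds(2)[OF c(1,3)] unfolding n_def m_def by linarith
  qed
  then have "\<gamma> * euclid_norm (n - m) \<le> \<gamma> * (K * (euclid_norm (teacher t - descent t) + 2 * (euclid_norm (x (Suc t)) + \<alpha> * K)))"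
    using gamma_bounds by (intro mult_left_mono) auto
  ultimately show ?thesis by linarith
qed

text \<open>Gronwall is applied to the teacher's error plus \<open>16 * c * E\<close>: over this
  horizon the growth factor is at most \<open>exp (A * K)\<close> and the forcing sums to at most
  \<open>C2 * A * \<alpha>\<close>. The student stays within O(\<alpha>) of the teacher.\<close>

lemma student_descent_le:
  assumes "real t * \<gamma> \<le> A"
  shows "euclid_norm (student t - descent t) \<le> (G * B + K + exp (A * K) * (16 * c * (J * K) + C2 * A)) * \<alpha>"
proof -
  note pos = const_pos kappa_pos alpha_pos eta_pos gamma_bounds(1)
  define f where "f t = euclid_norm (teacher t - descent t) + 16 * c * E t" for t
  have "f (Suc t) \<le> (1 + \<gamma> * K) * f t + C2 * \<gamma> * \<alpha>" for t
    unfolding f_def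
    by (rule averaging_step[OF euclid_norm_nonneg euclid_norm_nonneg teacher_step
          E_step(2)[OF E_small] E_step(1)[OF E_small] E_nonneg])
  then have "f t \<le> (1 + \<gamma> * K) ^ t * (f 0 + real t * (C2 * \<gamma> * \<alpha>))"
    using pos K_ge_1 E_nonneg by (intro discrete_gronwall) (auto simp: f_def)
  also have "\<dots> \<le> exp (A * K) * (16 * c * (J * K * \<alpha>) + A * (C2 * \<alpha>))"
  proof (rule mult_mono)
    have "(1 + \<gamma> * K) ^ t \<le> exp (\<gamma> * K) ^ t"
      using pos K_ge_1 by (intro power_mono) (auto simp: exp_ge_add_one_self)
    also have "\<dots> = exp ((real t * \<gamma>) * K)" by (simp add: exp_of_nat_mult[symmetric] mult.assoc)
    also have "\<dots> \<le> exp (A * K)" using assms K_ge_1 by (simp add: mult_right_mono)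
    finally show "(1 + \<gamma> * K) ^ t \<le> exp (A * K)" .
    have "teacher 0 - descent 0 = 0\<^sub>v N" using start by (simp add: state_0 descent_def)
    then have "f 0 \<le> 16 * c * (J * K * \<alpha>)" using E_0 pos by (simp add: f_def)
    moreover have "(real t * \<gamma>) * (C2 * \<alpha>) \<le> A * (C2 * \<alpha>)"
      using assms pos by (intro mult_right_mono) auto
    ultimately show "f 0 + real t * (C2 * \<gamma> * \<alpha>) \<le> 16 * c * (J * K * \<alpha>) + A * (C2 * \<alpha>)"
      by (simp add: ac_simps)
    show "0 \<le> f 0 + real t * (C2 * \<gamma> * \<alpha>)" using pos E_nonneg by (simp add: f_def)
  qed simp
  finally have f: "f t \<le> exp (A * K) * (16 * c * (J * K) + C2 * A) * \<alpha>" by (simp add: algebra_simps)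
  have "student t - descent t = (student t - teacher t) + (teacher t - descent t)"
    using carriers[of t] descent_carrier[of t] by (intro eq_vecI) auto
  then have "euclid_norm (student t - descent t) \<le> euclid_norm (student t - teacher t) + euclid_norm (teacher t - descent t)"
    using euclid_norm_triangle[of "student t - teacher t" N "teacher t - descent t"]
      carriers[of t] descent_carrier[of t] by simp
  also have "euclid_norm (student t - teacher t) \<le> G * (B * \<alpha>) + \<alpha> * K"
  proof -
    have "G * E t \<le> G * (B * \<alpha>)" using E_le pos by (intro mult_left_mono) auto
    then show ?thesis using distance_le[of t] E_step(2)[OF E_small, of t] by linarith
  qed
  also have "euclid_norm (teacher t - descent t) \<le> f t" using E_nonneg[of t] pos by (simp add: f_def)
  finally show ?thesis using f by (simp add: algebra_simps)
qed

end

theorem theorem3p1: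
  fixes \<kappa> lam \<mu> K A :: real
  assumes "\<kappa> > 0" and "lam \<ge> 0" and "0 \<le> \<mu>" and "\<mu> < 1" and "K \<ge> 1" and "A > 0"
  shows "\<exists>\<alpha>0 \<eta>0 C :: real. 0 < \<alpha>0 \<and> \<alpha>0 < 1 \<and> 0 < \<eta>0 \<and> \<eta>0 < 1 / \<kappa> \<and> C > 0 \<and>
    (\<forall>\<alpha> \<eta>. 0 < \<alpha> \<and> \<alpha> \<le> \<alpha>0 \<and> 0 < \<eta> \<and> \<eta> \<le> \<eta>0 \<longrightarrow>
      (let \<gamma> = \<kappa> * \<alpha> * \<eta> / (1 - \<kappa> * \<eta>);
           lam_bar = lam + (1 - \<mu>) * \<kappa> / (1 - \<eta> * \<kappa>)
       in \<forall>(N :: nat) (L :: real vec \<Rightarrow> real) (D :: real vec \<Rightarrow> real vec \<Rightarrow> real)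
            (H :: real vec \<Rightarrow> real mat) (\<theta>0 :: real vec) (T :: nat).
            differentiable_vec N L \<and>
            (\<forall>\<theta>'\<in>carrier_vec N. differentiable_vec N (\<lambda>\<theta>. D \<theta> \<theta>')) \<and>
            (\<forall>\<theta>\<in>carrier_vec N. sym_pos_def N (H \<theta>)) \<and>
            locally_quadratic N D H \<and>
            regularity_condition N K {lam, lam_bar} L D H \<and>
            \<theta>0 \<in> carrier_vec N \<and> T \<ge> 1 \<and> real T * \<gamma> \<le> A \<longrightarrow>
            (MAX t\<in>{..T}. euclid_norm (mean_teacher N L D \<eta> lam \<mu> \<alpha> \<kappa> \<theta>0 t
                                       - natural_descent N L H \<gamma> lam_bar \<theta>0 t))
              \<le> C * \<alpha> * ln (1 / \<alpha>)))"
proof -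
  interpret drift_constants \<kappa> \<mu> K using assms by unfold_locales
  obtain \<alpha>0 \<eta>0 where rates: "0 < \<alpha>0" "\<alpha>0 \<le> exp (- 1)" "0 < \<eta>0" "\<eta>0 < 1 / \<kappa>"
    and small: "\<And>\<alpha> \<eta>. 0 < \<alpha> \<Longrightarrow> \<alpha> \<le> \<alpha>0 \<Longrightarrow> 0 < \<eta> \<Longrightarrow> \<eta> \<le> \<eta>0 \<Longrightarrow> small_rates \<kappa> \<mu> K \<alpha> \<eta>"
    using small_rates_exist by blast
  \<comment> \<open>The constant of \<open>student_descent_le\<close>, fixed before \<alpha>,
    \<eta>, the dimension and the functions are given.\<close>
  define C where "C = G * B + K + exp (A * K) * (16 * c * (J * K) + C2 * A)"
  have C: "C > 0"
    unfolding C_def using const_pos assms by (intro add_pos_pos mult_pos_pos) auto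
  have "exp (- 1) < (1 :: real)" by simp
  then have "\<alpha>0 < 1" using rates by linarith
  moreover have "(MAX t\<in>{..T}. euclid_norm (mean_teacher N L D \<eta> lam \<mu> \<alpha> \<kappa> \<theta>0 t
        - natural_descent N L H (\<kappa> * \<alpha> * \<eta> / (1 - \<kappa> * \<eta>)) (lam + (1 - \<mu>) * \<kappa> / (1 - \<eta> * \<kappa>)) \<theta>0 t))
      \<le> C * \<alpha> * ln (1 / \<alpha>)"
    if range: "0 < \<alpha>" "\<alpha> \<le> \<alpha>0" "0 < \<eta>" "\<eta> \<le> \<eta>0"
      and hyps: "differentiable_vec N L"
        "\<forall>\<theta>'\<in>carrier_vec N. differentiable_vec N (\<lambda>\<theta>. D \<theta> \<theta>')"
        "\<forall>\<theta>\<in>carrier_vec N. sym_pos_def N (H \<theta>)"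
        "regularity_condition N K {lam, lam + (1 - \<mu>) * \<kappa> / (1 - \<eta> * \<kappa>)} L D H"
        "\<theta>0 \<in> carrier_vec N" "real T * (\<kappa> * \<alpha> * \<eta> / (1 - \<kappa> * \<eta>)) \<le> A"
    for \<alpha> \<eta> N L D H \<theta>0 T
  proof -
    interpret small_rates \<kappa> \<mu> K \<alpha> \<eta> using small range by blast
    interpret mean_teacher_run \<kappa> \<mu> K \<alpha> \<eta> lam N L D H \<theta>0
      using assms hyps by unfold_locales auto
    \<comment> \<open>The logarithm is at least 1, so the O(\<alpha>) estimate implies the stated
      one.\<close>
    have "ln \<alpha> \<le> ln (exp (- 1))" using range rates by (subst ln_le_cancel_iff) auto
    then have "1 \<le> ln (1 / \<alpha>)" using range by (simp add: ln_div)
    then have log: "C * \<alpha> * 1 \<le> C * \<alpha> * ln (1 / \<alpha>)" using C range by (intro mult_left_mono) auto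
    have "euclid_norm (student t - descent t) \<le> C * \<alpha>" if "t \<le> T" for t
    proof -
      have "real t * \<gamma> \<le> real T * \<gamma>" using that gamma_bounds by (intro mult_right_mono) auto
      then show ?thesis
        unfolding C_def using hyps by (intro student_descent_le) (simp add: \<gamma>_def)
    qed
    then have "euclid_norm (mean_teacher N L D \<eta> lam \<mu> \<alpha> \<kappa> \<theta>0 t
        - natural_descent N L H (\<kappa> * \<alpha> * \<eta> / (1 - \<kappa> * \<eta>)) (lam + (1 - \<mu>) * \<kappa> / (1 - \<eta> * \<kappa>)) \<theta>0 t)
      \<le> C * \<alpha> * ln (1 / \<alpha>)" if "t \<le> T" for t
      using log that unfolding student_def state_def descent_def \<gamma>_def lam_bar_def mean_teacher_def
      by fastforce
    then show ?thesis by (subst Max_le_iff) auto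
  qed
  ultimately show ?thesis
    using rates C unfolding Let_def by (intro exI[of _ \<alpha>0] exI[of _ \<eta>0] exI[of _ C]) blast
qed

end
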